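(* Assume that $\ell:=\lim_{p\to\infty}q(p)/p\in[0,1)$ exists. Let $u_\infty$ be a uniform limit of the family of nonnegative weak solutions $u_p$ of $$-\Delta_p u_p(x)+\lambda_0(x)\,(u_p)_+^{q(p)}(x)=0\ \text{ in }\Omega,\qquad u_p=g\ \text{ on }\partial\Omega,$$ with $g\in\mathrm{Lip}(\partial\Omega)$, and let $\Omega'\Subset\Omega$. Then for any $x_0\in\partial\{u_\infty>0\}\cap\Omega'$ and any $0<r\ll1$ (i.e. for all $0<r<r_0$, for some small $r_0>0$ not depending on $x_0$), $$\sup_{B_r(x_0)}u_\infty(x)\ \le\ 2\cdot2^{\frac1{1-\ell}}(1-\ell)^{\frac1{1-\ell}}\,r^{\frac1{1-\ell}} .$$
   Context: $\Omega\subset\mathbb R^N$ is a regular bounded domain; $\lambda_0$ is a bounded function on $\Omega$ which is bounded away from zero ($0<\inf_\Omega\lambda_0\le\sup_\Omega\lambda_0<\infty$); $g\ge0$; $p\ge2$ and $0\le q(p)<p-1$; $\lambda_0$ and $g$ do not depend on $p$. $\Delta_pu=\mathrm{div}(|\nabla u|^{p-2}\nabla u)$, $u_+=\max\{u,0\}$, and $u_+^0$ means $\chi_{\{u>0\}}$. A weak solution is $u\in W^{1,p}_{\rm loc}(\Omega)$ with $\int_\Omega|\nabla u|^{p-2}\nabla u\cdot\nabla\varphi\,dx=-\int_\Omega\lambda_0u_+^q\varphi\,dx$ for all $0\le\varphi\in C_0^1(\Omega)$, with $u=g$ on $\partial\Omega$. "$u_\infty$ is a uniform limit of the family $u_p$"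 means that there is a sequence $p_j\to\infty$ with $u_{p_j}\to u_\infty$ uniformly in $\overline\Omega$. *)

theory Defs
  imports "HOL-Analysis.Analysis"
begin

text \<open>A bounded domain with Lipschitz boundary: near every boundary point the set is the strict
  epigraph, in some direction \<open>e\<close>, of a Lipschitz function \<open>\<gamma>\<close> of the component orthogonal to \<open>e\<close>.\<close>

definition lipschitz_boundary :: "'a::euclidean_space set \<Rightarrow> bool" where
  "lipschitz_boundary \<Omega> \<longleftrightarrow>
     (\<forall>z\<in>frontier \<Omega>. \<exists>U e \<gamma> L. open U \<and> z \<in> U \<and> norm e = 1 \<and> L-lipschitz_on UNIV \<gamma> \<and>
        \<Omega> \<inter> U = {x \<in> U. \<gamma> (x - (x \<bullet> e) *\<^sub>R e) < x \<bullet> e})"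

definition regular_bounded_domain :: "'a::euclidean_space set \<Rightarrow> bool" where
  "regular_bounded_domain \<Omega> \<longleftrightarrow>
     open \<Omega> \<and> connected \<Omega> \<and> \<Omega> \<noteq> {} \<and> bounded \<Omega> \<and> lipschitz_boundary \<Omega>"

definition compactly_contained :: "'a::euclidean_space set \<Rightarrow> 'a set \<Rightarrow> bool" where
  "compactly_contained \<Omega>' \<Omega> \<longleftrightarrow> open \<Omega>' \<and> compact (closure \<Omega>') \<and> closure \<Omega>' \<subseteq> \<Omega>"

text \<open>\<open>\<phi> \<in> C\<^sub>0\<^sup>1(\<Omega>)\<close> (compact support in \<open>\<Omega>\<close>, extended by zero to the whole space), with gradient \<open>D\<close>.\<close>

definition C01_test :: "'a::euclidean_space set \<Rightarrow> ('a \<Rightarrow> real) \<Rightarrow> ('a \<Rightarrow> 'a) \<Rightarrow> bool" where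
  "C01_test \<Omega> \<phi> D \<longleftrightarrow>
     (\<forall>x. GDERIV \<phi> x :> D x) \<and> continuous_on UNIV D \<and>
     compact (closure {x. \<phi> x \<noteq> 0}) \<and> closure {x. \<phi> x \<noteq> 0} \<subseteq> \<Omega>"

definition Lp_loc ::
    "real \<Rightarrow> 'a::euclidean_space set \<Rightarrow> ('a \<Rightarrow> 'b::euclidean_space) \<Rightarrow> bool" where
  "Lp_loc p \<Omega> f \<longleftrightarrow>
     f \<in> borel_measurable (lebesgue_on \<Omega>) \<and>
     (\<forall>K. compact K \<and> K \<subseteq> \<Omega> \<longrightarrow> integrable (lebesgue_on K) (\<lambda>x. norm (f x) powr p))"

text \<open>The integral identity is vector valued, so it collects the defining identities of all weak
  partial derivatives. For locally integrable functions, testing with \<open>C\<^sub>0\<^sup>1\<close> and with compactly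
  supported smooth functions gives the same notion.\<close>

definition weak_gradient ::
    "'a::euclidean_space set \<Rightarrow> ('a \<Rightarrow> real) \<Rightarrow> ('a \<Rightarrow> 'a) \<Rightarrow> bool" where
  "weak_gradient \<Omega> u G \<longleftrightarrow>
     (\<forall>\<phi> D. C01_test \<Omega> \<phi> D \<longrightarrow>
        integral\<^sup>L (lebesgue_on \<Omega>) (\<lambda>x. u x *\<^sub>R D x) =
          - integral\<^sup>L (lebesgue_on \<Omega>) (\<lambda>x. \<phi> x *\<^sub>R G x))"

text \<open>\<open>u \<in> W\<^sub>l\<^sub>o\<^sub>c\<^sup>1\<^sup>,\<^sup>p(\<Omega>)\<close> with weak gradient \<open>G\<close>.\<close>

definition W1p_loc ::
    "real \<Rightarrow> 'a::euclidean_space set \<Rightarrow> ('a \<Rightarrow> real) \<Rightarrow> ('a \<Rightarrow> 'a) \<Rightarrow> bool" where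
  "W1p_loc p \<Omega> u G \<longleftrightarrow> Lp_loc p \<Omega> u \<and> Lp_loc p \<Omega> G \<and> weak_gradient \<Omega> u G"

text \<open>Weak solutions of \<open>-\<Delta>\<^sub>p u + lam0 u\<^sub>+\<^sup>q = 0\<close> in \<open>\<Omega>\<close>, \<open>u = g\<close> on the boundary. The boundary values
  are attained pointwise by the representative of \<open>u\<close> that is continuous up to the boundary.
  Since \<open>0 powr 0 = 0\<close>, for \<open>q = 0\<close> the term \<open>max (u x) 0 powr q\<close> is the characteristic function
  of \<open>{u > 0}\<close>, which is the intended reading of \<open>u\<^sub>+\<^sup>0\<close>.\<close>

definition weak_solution ::
    "real \<Rightarrow> real \<Rightarrow> ('a::euclidean_space \<Rightarrow> real) \<Rightarrow> 'a set \<Rightarrow> ('a \<Rightarrow> real) \<Rightarrow> ('a \<Rightarrow> real) \<Rightarrow> bool"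
  where
  "weak_solution p q lam0 \<Omega> g u \<longleftrightarrow>
     continuous_on (closure \<Omega>) u \<and>
     (\<forall>x\<in>frontier \<Omega>. u x = g x) \<and>
     (\<exists>G. W1p_loc p \<Omega> u G \<and>
        (\<forall>\<phi> D. C01_test \<Omega> \<phi> D \<and> (\<forall>x. 0 \<le> \<phi> x) \<longrightarrow>
           integral\<^sup>L (lebesgue_on \<Omega>) (\<lambda>x. norm (G x) powr (p - 2) * (G x \<bullet> D x)) =
             - integral\<^sup>L (lebesgue_on \<Omega>) (\<lambda>x. lam0 x * max (u x) 0 powr q * \<phi> x)))"

definition uniform_limit_of_family ::
    "'a::euclidean_space set \<Rightarrow> (real \<Rightarrow> 'a \<Rightarrow> real) \<Rightarrow> ('a \<Rightarrow> real) \<Rightarrow> bool" where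
  "uniform_limit_of_family \<Omega> u v \<longleftrightarrow>
     (\<exists>P :: nat \<Rightarrow> real. filterlim P at_top sequentially \<and>
        uniform_limit (closure \<Omega>) (\<lambda>j. u (P j)) v sequentially)"

end

theory Submission
  imports Defs
begin

text \<open>
  Formally, where it is positive, a uniform limit \<open>v\<close> of the solutions satisfies
  \<open>min {\<Delta>\<^sub>\<infinity> v, |\<nabla>v| - v powr l} = 0\<close>. Hence no function touches \<open>v\<close> from below that is strictly
  convex in the direction of its gradient and steeper than its own \<open>l\<close>-th power. This lower bound
  for \<open>v\<close> gives the upper bound for its growth: a radial function of this kind, centred at a point
  \<open>y\<close> where \<open>v\<close> is large, lies below \<open>v\<close> and forces \<open>v\<close> to be positive at all points of the
  ball where the function is positive. If this ball contains a zero \<open>x0\<close> of \<open>v\<close>, then \<open>v y\<close>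
  cannot exceed the height of the radial function.

  The critical profile, with slope equal to the \<open>l\<close>-th power, is
  \<open>((1 - l) * (r - s)) powr (1 / (1 - l))\<close>. The barrier used here has
  \<open>3 / 2 * (r - s) + (r - s)\<^sup>2 / (2 * r)\<close> in place of \<open>r - s\<close>; it is steeper by the factor
  \<open>3 / 2\<close>, strictly convex, and of height \<open>((1 - l) * (2 * r)) powr (1 / (1 - l))\<close>.

  The argument is carried out for the weak solutions \<open>u p\<close> themselves and not for the limit equation.
  By \<open>barrier_strict_subsolution\<close> the barrier is a strict subsolution for all large \<open>p\<close>: the factor
  \<open>(3 / 2) powr (p - 1)\<close> beats the absorption coefficient and the \<open>o(p)\<close> discrepancy between \<open>q p\<close>
  and \<open>l * p\<close>, and the convexity, multiplied by \<open>p - 1\<close>, beats the curvature of the spheres. The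
  vertex of the barrier is avoided by an annulus whose inner ball is independent of \<open>p\<close>; there uniform
  convergence keeps \<open>u p\<close> above the barrier.

  What remains is a comparison principle for weak solutions, \<open>weak_comparison_principle\<close>. Since
  test functions are continuously differentiable, it rests on the approximation of a Sobolev function
  by mollification, \<open>Sobolev_local_C1_approx\<close>. The barrier enters in weak form through
  \<open>radial_weak_p_Laplacian\<close>, an integration by parts obtained by differentiating the dilation
  invariance of the integral.
\<close>

section \<open>Powers and integrals over compact sets\<close>

lemma powr_norm_add_le:
  fixes a b :: "'a::real_normed_vector"
  assumes "0 \<le> p"
  shows "norm (a + b) powr p \<le> 2 powr p * (norm a powr p + norm b powr p)"
proof -
  have "norm (a + b) \<le> 2 * max (norm a) (norm b)"
    using norm_triangle_ineq[of a b] by linarith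
  then have "norm (a + b) powr p \<le> (2 * max (norm a) (norm b)) powr p"
    using assms by (intro powr_mono2) auto
  also have "\<dots> = 2 powr p * max (norm a) (norm b) powr p"
    by (simp add: powr_mult)
  also have "\<dots> \<le> 2 powr p * (norm a powr p + norm b powr p)"
    by (intro mult_left_mono) (auto simp: max_def)
  finally show ?thesis .
qed

lemma powr_le_one_plus_powr:
  fixes t :: real
  assumes "0 \<le> t" "0 \<le> a" "a \<le> b"
  shows "t powr a \<le> 1 + t powr b"
proof (cases "t \<le> 1")
  case True
  then have "t powr a \<le> 1 powr a" using assms by (intro powr_mono2) auto
  then show ?thesis using powr_ge_zero[of t b] by (simp del: powr_ge_zero)
next
  case False
  then have "t powr a \<le> t powr b" using assms by (intro powr_mono) auto
  then show ?thesis by simp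
qed

lemma Jensen_powr:
  fixes k f :: "'a \<Rightarrow> real"
  assumes p: "1 < p" and k: "integrable M k" "\<And>x. 0 \<le> k x" "(\<integral>x. k x \<partial>M) = 1"
    and f: "\<And>x. 0 \<le> f x" "integrable M (\<lambda>x. k x * f x)" "integrable M (\<lambda>x. k x * f x powr p)"
  shows "(\<integral>x. k x * f x \<partial>M) powr p \<le> (\<integral>x. k x * f x powr p \<partial>M)"
proof -
  define a where "a = (\<integral>x. k x * f x \<partial>M)"
  have a: "0 \<le> a" unfolding a_def using k f by (intro Bochner_Integration.integral_nonneg) auto
  (* Tangent inequality for the power at the mean value a: Young's inequality with f x and a powr (p - 1). *)
  have *: "p * (a powr (p - 1) * f x) \<le> f x powr p + (p - 1) * a powr p" for x
  proof -
    have "f x * a powr (p - 1) \<le> f x powr p / p + (a powr (p - 1)) powr (p / (p - 1)) / (p / (p - 1))"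
      using p f a by (intro Youngs_inequality) (auto simp: field_simps)
    also have "(a powr (p - 1)) powr (p / (p - 1)) = a powr p"
      using p by (simp add: powr_powr)
    finally have "p * (f x * a powr (p - 1)) \<le> p * (f x powr p / p + a powr p / (p / (p - 1)))"
      using p by (intro mult_left_mono) auto
    also have "\<dots> = f x powr p + (p - 1) * a powr p"
      using p by (simp add: field_simps)
    finally show ?thesis by (simp add: mult.commute)
  qed
  have "(\<integral>x. p * a powr (p - 1) * (k x * f x) \<partial>M) \<le> (\<integral>x. k x * f x powr p + (p - 1) * a powr p * k x \<partial>M)"
  proof (rule integral_mono)
    fix x
    show "p * a powr (p - 1) * (k x * f x) \<le> k x * f x powr p + (p - 1) * a powr p * k x"
      using mult_left_mono[OF * k(2)[of x], of x] by (simp add: algebra_simps)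
  qed (use k f in auto)
  then have "p * a powr (p - 1) * a \<le> (\<integral>x. k x * f x powr p \<partial>M) + (p - 1) * a powr p"
    using k f by (simp add: a_def)
  moreover have "a powr (p - 1) * a = a powr p"
    using powr_mult_base[of a "p - 1"] a by (simp add: mult.commute)
  ultimately have "p * a powr p \<le> (\<integral>x. k x * f x powr p \<partial>M) + (p - 1) * a powr p"
    by (metis mult.assoc)
  then show ?thesis
    unfolding a_def[symmetric] by (simp add: algebra_simps)
qed

text \<open>Continuity of the pairing of \<open>L\<^sup>p\<close> with its dual. The bound \<open>d\<close> is found
  before \<open>a\<close> is given; in the comparison principle it is the accuracy requested from the
  approximation.\<close>

lemma Lp_pairing_small:
  fixes H :: "'a \<Rightarrow> real"
  assumes p: "1 < p" and H: "\<And>x. 0 \<le> H x" "H \<in> borel_measurable M" "integrable M (\<lambda>x. H x powr (p / (p - 1)))"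
    and c: "0 < c"
  obtains d where "0 < d"
    "\<And>a. (\<And>x. 0 \<le> a x) \<Longrightarrow> a \<in> borel_measurable M \<Longrightarrow> integrable M (\<lambda>x. a x powr p) \<Longrightarrow>
      (\<integral>x. a x powr p \<partial>M) \<le> d \<Longrightarrow> integrable M (\<lambda>x. H x * a x) \<and> (\<integral>x. H x * a x \<partial>M) \<le> c"
proof -
  define q where "q = p / (p - 1)"
  have q: "1 < q" "1 / p + 1 / q = 1" using p by (auto simp: q_def field_simps)
  define I where "I = (\<integral>x. H x powr q \<partial>M)"
  have I: "0 \<le> I" unfolding I_def by (intro Bochner_Integration.integral_nonneg) auto
  (* Young's inequality is applied to (a x / t) * (t * H x); the weight t makes the H-part at most c / 2. *)
  define t where "t = (c / (2 * (I + 1))) powr (1 / q)"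
  have t: "0 < t" "t powr q = c / (2 * (I + 1))"
    using c I q by (auto simp: t_def powr_powr)
  define d where "d = t powr p * c / 2"
  show ?thesis
  proof (rule that[of d])
    show "0 < d" using t c by (simp add: d_def)
    fix a assume a: "\<And>x. 0 \<le> a x" "a \<in> borel_measurable M" "integrable M (\<lambda>x. a x powr p)"
      "(\<integral>x. a x powr p \<partial>M) \<le> d"
    have le: "H x * a x \<le> t powr q * H x powr q + a x powr p / t powr p" for x
    proof -
      have "H x * a x = (a x / t) * (t * H x)" using t by simp
      also have "\<dots> \<le> (a x / t) powr p / p + (t * H x) powr q / q"
        using p q a H t by (intro Youngs_inequality) auto
      also have "\<dots> \<le> (a x / t) powr p + (t * H x) powr q"
        using p q divide_left_mono[of 1 p "(a x / t) powr p"] divide_left_mono[of 1 q "(t * H x) powr q"] by (intro add_mono) auto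
      finally show ?thesis using a H t by (simp add: powr_divide powr_mult add.commute)
    qed
    let ?R = "\<lambda>x. t powr q * H x powr q + a x powr p / t powr p"
    have intR: "integrable M ?R" using a H by (auto simp: q_def)
    have int: "integrable M (\<lambda>x. H x * a x)"
    proof (rule Bochner_Integration.integrable_bound[OF intR])
      show "(\<lambda>x. H x * a x) \<in> borel_measurable M" using a(2) H(2) by measurable
      show "AE x in M. norm (H x * a x) \<le> norm (?R x)"
        using le a(1) H(1) by (intro AE_I2) (simp add: order_trans[OF le abs_ge_self])
    qed
    have "(\<integral>x. H x * a x \<partial>M) \<le> (\<integral>x. ?R x \<partial>M)"
      by (rule integral_mono[OF int intR]) (rule le)
    also have "\<dots> = t powr q * I + (\<integral>x. a x powr p \<partial>M) / t powr p"
      using a H by (simp add: I_def q_def)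
    also have "\<dots> \<le> t powr q * (I + 1) + d / t powr p"
      using a(4) t(1) by (intro add_mono divide_right_mono mult_left_mono) auto
    also have "\<dots> = c" using t c I by (simp add: d_def field_simps)
    finally show "integrable M (\<lambda>x. H x * a x) \<and> (\<integral>x. H x * a x \<partial>M) \<le> c" using int by simp
  qed
qed

lemma integral_lebesgue_on_extend:
  fixes f :: "'a::euclidean_space \<Rightarrow> 'b::euclidean_space"
  assumes "S \<in> sets lebesgue" "T \<in> sets lebesgue" "S \<subseteq> T" "\<And>x. x \<in> T - S \<Longrightarrow> f x = 0"
  shows "integral\<^sup>L (lebesgue_on T) f = integral\<^sup>L (lebesgue_on S) f"
proof -
  have "integral\<^sup>L lebesgue (\<lambda>x. if x \<in> T then f x else 0) = integral\<^sup>L lebesgue (\<lambda>x. if x \<in> S then f x else 0)"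
    using assms(3,4) by (intro arg_cong[where f="integral\<^sup>L lebesgue"]) (auto simp: fun_eq_iff)
  then show ?thesis
    using assms by (simp add: Lebesgue_Measure.integral_restrict_UNIV)
qed

lemma integral_lebesgue_restrict:
  fixes f :: "'a::euclidean_space \<Rightarrow> 'b::euclidean_space"
  assumes "S \<in> sets lebesgue" "\<And>x. x \<notin> S \<Longrightarrow> f x = 0"
  shows "integral\<^sup>L lebesgue f = integral\<^sup>L (lebesgue_on S) f"
  using integral_lebesgue_on_extend[of S UNIV f] assms by (simp add: lebesgue_on_UNIV_eq)

lemma compact_in_sets_lebesgue:
  "compact C \<Longrightarrow> C \<in> sets lebesgue"
  by (rule fmeasurableD[OF lmeasurable_compact])

lemma finite_measure_lebesgue_on_compact:
  "compact C \<Longrightarrow> finite_measure (lebesgue_on C)"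
  by (simp add: compact_imp_bounded finite_measure_lebesgue_on lmeasurable_compact)

lemma lebesgue_on_mono_integrable:
  fixes f :: "'a::euclidean_space \<Rightarrow> 'b::{banach, second_countable_topology}"
  assumes "integrable (lebesgue_on T) f" "S \<subseteq> T" "S \<in> sets lebesgue" "T \<in> sets lebesgue"
  shows "integrable (lebesgue_on S) f"
proof -
  have "set_integrable lebesgue T f"
    using assms by (simp add: set_integrable_def integrable_restrict_space)
  then have "set_integrable lebesgue S f"
    using assms by (rule_tac set_integrable_subset) auto
  then show ?thesis using assms by (simp add: set_integrable_def integrable_restrict_space)
qed

lemma integrable_of_powr:
  fixes G :: "'a \<Rightarrow> 'b::{banach, second_countable_topology}"
  assumes "finite_measure M" "G \<in> borel_measurable M" "integrable M (\<lambda>x. norm (G x) powr p)" "1 \<le> p"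
  shows "integrable M G"
proof (rule Bochner_Integration.integrable_bound[where f="\<lambda>x. 1 + norm (G x) powr p"])
  interpret finite_measure M by fact
  show "integrable M (\<lambda>x. 1 + norm (G x) powr p)" using assms by auto
  have "norm (G x) \<le> 1 + norm (G x) powr p" for x
  proof (cases "norm (G x) \<le> 1")
    case False
    then have "norm (G x) powr 1 \<le> norm (G x) powr p"
      using assms(4) by (intro powr_mono) auto
    then show ?thesis using False by simp
  qed (use powr_ge_zero[of "norm (G x)" p] in linarith)
  then show "AE x in M. norm (G x) \<le> norm (1 + norm (G x) powr p)"
    by (intro AE_I2) (smt (verit) real_norm_def powr_ge_zero)
qed fact

lemma continuous_on_compact_norm_bound:
  fixes f :: "'a::topological_space \<Rightarrow> 'b::real_normed_vector"
  assumes "compact K" "continuous_on K f"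
  obtains B where "0 < B" "\<And>x. x \<in> K \<Longrightarrow> norm (f x) \<le> B"
proof -
  obtain B where "0 < B" "\<forall>y\<in>f ` K. norm y \<le> B"
    using compact_imp_bounded[OF compact_continuous_image[OF assms(2,1)]] unfolding bounded_pos by blast
  then show ?thesis using that by blast
qed

lemma integrable_lebesgue_on_compact_continuous:
  fixes f :: "'a::euclidean_space \<Rightarrow> 'b::euclidean_space"
  assumes K: "compact K" and f: "continuous_on K f"
  shows "integrable (lebesgue_on K) f"
proof -
  interpret finite_measure "lebesgue_on K" by (rule finite_measure_lebesgue_on_compact[OF K])
  obtain M where "\<And>x. x \<in> K \<Longrightarrow> norm (f x) \<le> M"
    using compact_imp_bounded[OF compact_continuous_image[OF f K]] by (auto simp: bounded_iff)
  moreover have "f \<in> borel_measurable (lebesgue_on K)"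
    by (rule continuous_imp_measurable_on_sets_lebesgue[OF f compact_in_sets_lebesgue[OF K]])
  ultimately show ?thesis
    by (intro integrable_const_bound[where B=M] AE_I2) auto
qed

text \<open>Density of the continuous functions: truncating \<open>G\<close> at a high level costs little, and the
  bounded truncation is an almost everywhere limit of continuous functions with the same bound, to which
  dominated convergence applies on the compact set.\<close>

lemma Lp_continuous_approx:
  fixes G :: "'a::euclidean_space \<Rightarrow> 'b::euclidean_space"
  assumes C: "compact C" and G: "G \<in> borel_measurable (lebesgue_on C)"
    and Gp: "integrable (lebesgue_on C) (\<lambda>x. norm (G x) powr p)" and p: "0 < p" and e: "0 < e"
  obtains g where "continuous_on UNIV g" "integrable (lebesgue_on C) (\<lambda>x. norm (G x - g x) powr p)"
    "(\<integral>x. norm (G x - g x) powr p \<partial>lebesgue_on C) < e"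
proof -
  note [measurable] = G
  interpret finite_measure "lebesgue_on C"
    by (rule finite_measure_lebesgue_on_compact[OF C])
  define H where "H k x = (if norm (G x) \<le> real k then G x else 0)" for k x
  have [measurable]: "H k \<in> borel_measurable (lebesgue_on C)" for k
    unfolding H_def by measurable
  have "(\<lambda>k. \<integral>x. norm (G x - H k x) powr p \<partial>lebesgue_on C) \<longlonglongrightarrow> (\<integral>x. 0 \<partial>lebesgue_on C)"
  proof (rule integral_dominated_convergence[where w="\<lambda>x. norm (G x) powr p"])
    show "AE x in lebesgue_on C. (\<lambda>k. norm (G x - H k x) powr p) \<longlonglongrightarrow> 0"
    proof (intro AE_I2 tendsto_eventually)
      fix x show "\<forall>\<^sub>F k in sequentially. norm (G x - H k x) powr p = 0"
        using eventually_ge_at_top[of "nat \<lceil>norm (G x)\<rceil>"]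
        by eventually_elim (auto simp: H_def nat_ceiling_le_eq)
    qed
    show "AE x in lebesgue_on C. norm (norm (G x - H k x) powr p) \<le> norm (G x) powr p" for k
      by (auto simp: H_def)
  qed (use Gp in auto)
  then have "(\<lambda>k. \<integral>x. norm (G x - H k x) powr p \<partial>lebesgue_on C) \<longlonglongrightarrow> 0"
    by simp
  then have "\<forall>\<^sub>F k in sequentially. (\<integral>x. norm (G x - H k x) powr p \<partial>lebesgue_on C) < e / (2 * 2 powr p)"
    using e by (intro order_tendstoD) auto
  then have "\<forall>\<^sub>F k in sequentially. (\<integral>x. norm (G x - H k x) powr p \<partial>lebesgue_on C) < e / (2 * 2 powr p) \<and> k > 0"
    using eventually_gt_at_top[of 0] by eventually_elim auto
  then obtain k where k: "(\<integral>x. norm (G x - H k x) powr p \<partial>lebesgue_on C) < e / (2 * 2 powr p)" "k > 0"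
    by (auto dest: eventually_happens)
  have intk: "integrable (lebesgue_on C) (\<lambda>x. norm (G x - H k x) powr p)"
    by (rule Bochner_Integration.integrable_bound[OF Gp]) (auto simp: H_def)
  have "H k measurable_on C"
    using C by (subst measurable_on_iff_borel_measurable) (auto intro: compact_in_sets_lebesgue)
  then obtain N g where N: "negligible N" and g: "\<And>n. continuous_on UNIV (g n)"
    and lim: "\<And>x. x \<notin> N \<Longrightarrow> (\<lambda>n. g n x) \<longlonglongrightarrow> (if x \<in> C then H k x else 0)"
    unfolding measurable_on_def by blast
  (* The continuous functions g n need not be bounded; composing with the radial retraction r onto
     the ball of radius k makes dominated convergence applicable and does not move H k. *)
  define r :: "'b \<Rightarrow> 'b" where "r y = (real k / max (real k) (norm y)) *\<^sub>R y" for y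
  have r_cont: "continuous_on UNIV r"
    unfolding r_def using k(2) by (intro continuous_intros) (auto simp: max_def)
  have r_norm: "norm (r y) \<le> real k" for y
    using k(2) by (auto simp: r_def max_def field_simps)
  have r_id: "norm y \<le> real k \<Longrightarrow> r y = y" for y
    using k(2) by (auto simp: r_def max_def)
  define h where "h n x = r (g n x)" for n x
  have h: "continuous_on UNIV (h n)" for n
    unfolding h_def by (rule continuous_on_compose2[OF r_cont g]) auto
  have hm[measurable]: "h n \<in> borel_measurable (lebesgue_on C)" for n
    using C by (intro continuous_imp_measurable_on_sets_lebesgue continuous_on_subset[OF h]) (auto intro: compact_in_sets_lebesgue)
  have bd: "norm (H k x - h n x) powr p \<le> (2 * real k) powr p" for n x
  proof (rule powr_mono2)
    have "norm (H k x) \<le> real k" by (auto simp: H_def)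
    then show "norm (H k x - h n x) \<le> 2 * real k"
      using r_norm[of "g n x"] norm_triangle_ineq4[of "H k x" "h n x"] by (auto simp: h_def)
  qed (use p in auto)
  have "(\<lambda>n. \<integral>x. norm (H k x - h n x) powr p \<partial>lebesgue_on C) \<longlonglongrightarrow> (\<integral>x. 0 \<partial>lebesgue_on C)"
  proof (rule integral_dominated_convergence[where w="\<lambda>x. (2 * real k) powr p"])
    have "N \<in> null_sets lebesgue"
      using N by (simp add: negligible_iff_null_sets)
    then have "AE x in lebesgue. x \<notin> N" by (rule AE_not_in)
    then have "AE x in lebesgue_on C. x \<notin> N"
      using C by (subst AE_restrict_space_iff) (auto intro: compact_in_sets_lebesgue)
    then show "AE x in lebesgue_on C. (\<lambda>n. norm (H k x - h n x) powr p) \<longlonglongrightarrow> 0"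
    proof (rule AE_mp, intro AE_I2 impI)
      fix x assume x: "x \<in> space (lebesgue_on C)" "x \<notin> N"
      then have "(\<lambda>n. g n x) \<longlonglongrightarrow> H k x" using lim[of x] by (auto simp: space_restrict_space)
      then have "(\<lambda>n. h n x) \<longlonglongrightarrow> r (H k x)"
        unfolding h_def using r_cont by (auto intro: continuous_on_tendsto_compose)
      moreover have "r (H k x) = H k x"
        by (rule r_id) (auto simp: H_def)
      ultimately have "(\<lambda>n. norm (H k x - h n x)) \<longlonglongrightarrow> norm (H k x - H k x)"
        by (intro tendsto_intros) auto
      then have "(\<lambda>n. norm (H k x - h n x) powr p) \<longlonglongrightarrow> 0 powr p"
        using p by (intro tendsto_powr') auto
      then show "(\<lambda>n. norm (H k x - h n x) powr p) \<longlonglongrightarrow> 0" using p by simp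
    qed
    show "AE x in lebesgue_on C. norm (norm (H k x - h n x) powr p) \<le> (2 * real k) powr p" for n
      using bd by (intro AE_I2) auto
  qed auto
  then have "(\<lambda>n. \<integral>x. norm (H k x - h n x) powr p \<partial>lebesgue_on C) \<longlonglongrightarrow> 0" by simp
  then have "\<forall>\<^sub>F n in sequentially. (\<integral>x. norm (H k x - h n x) powr p \<partial>lebesgue_on C) < e / (2 * 2 powr p)"
    using e by (intro order_tendstoD) auto
  then obtain n where n: "(\<integral>x. norm (H k x - h n x) powr p \<partial>lebesgue_on C) < e / (2 * 2 powr p)"
    by (auto dest: eventually_happens)
  have intn: "integrable (lebesgue_on C) (\<lambda>x. norm (H k x - h n x) powr p)"
    by (rule Bochner_Integration.integrable_bound[of _ "\<lambda>x. (2 * real k) powr p"]) (use bd in auto)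
  have le: "norm (G x - h n x) powr p \<le> 2 powr p * (norm (G x - H k x) powr p + norm (H k x - h n x) powr p)" for x
    using powr_norm_add_le[of p "G x - H k x" "H k x - h n x"] p by simp
  have int: "integrable (lebesgue_on C) (\<lambda>x. 2 powr p * (norm (G x - H k x) powr p + norm (H k x - h n x) powr p))"
    using intk intn by auto
  have intG: "integrable (lebesgue_on C) (\<lambda>x. norm (G x - h n x) powr p)"
    by (rule Bochner_Integration.integrable_bound[OF int]) (use le in \<open>auto intro: order_trans\<close>)
  have "(\<integral>x. norm (G x - h n x) powr p \<partial>lebesgue_on C)
      \<le> (\<integral>x. 2 powr p * (norm (G x - H k x) powr p + norm (H k x - h n x) powr p) \<partial>lebesgue_on C)"
    by (rule integral_mono[OF intG int]) (rule le)
  also have "\<dots> = 2 powr p * ((\<integral>x. norm (G x - H k x) powr p \<partial>lebesgue_on C) + (\<integral>x. norm (H k x - h n x) powr p \<partial>lebesgue_on C))"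
    using intk intn by simp
  also have "\<dots> < 2 powr p * (e / (2 * 2 powr p) + e / (2 * 2 powr p))"
    using k n by (intro mult_strict_left_mono) auto
  also have "\<dots> = e" by (simp add: field_simps)
  finally show ?thesis by (rule that[OF h intG])
qed

section \<open>Convolution with smooth kernels\<close>

text \<open>Tonelli's theorem is applied to a Borel version of \<open>F\<close>, since the convolution of a merely
  Lebesgue measurable function is not jointly measurable on the Borel product.\<close>

lemma nn_integral_lebesgue_convolution:
  fixes F :: "'a::euclidean_space \<Rightarrow> ennreal" and k :: "'a \<Rightarrow> ennreal"
  assumes F: "F \<in> borel_measurable lebesgue" and k: "k \<in> borel_measurable borel"
    and k1: "(\<integral>\<^sup>+x. k x \<partial>lborel) = 1"
  shows "(\<integral>\<^sup>+z. (\<integral>\<^sup>+x. k (z - x) * F x \<partial>lebesgue) \<partial>lebesgue) = (\<integral>\<^sup>+x. F x \<partial>lebesgue)"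
proof -
  note [measurable] = k
  obtain F' where F'[measurable]: "F' \<in> borel_measurable lborel" and ae: "AE x in lborel. F x = F' x"
    using completion_ex_borel_measurable[OF F] by blast
  have "(\<integral>\<^sup>+z. (\<integral>\<^sup>+x. k (z - x) * F x \<partial>lebesgue) \<partial>lebesgue) = (\<integral>\<^sup>+z. (\<integral>\<^sup>+x. k (z - x) * F' x \<partial>lborel) \<partial>lborel)"
    unfolding nn_integral_completion
    by (intro nn_integral_cong nn_integral_cong_AE) (use ae in auto)
  also have "\<dots> = (\<integral>\<^sup>+x. (\<integral>\<^sup>+z. k (z - x) * F' x \<partial>lborel) \<partial>lborel)"
    by (rule lborel_pair.Fubini'[symmetric]) measurable
  also have "\<dots> = (\<integral>\<^sup>+x. F' x \<partial>lborel)"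
  proof (rule nn_integral_cong)
    fix x
    have "(\<integral>\<^sup>+z. k (z - x) * F' x \<partial>lborel) = (\<integral>\<^sup>+z. k (z - x) \<partial>lborel) * F' x"
      by (rule nn_integral_multc) measurable
    also have "(\<integral>\<^sup>+z. k (z - x) \<partial>lborel) = (\<integral>\<^sup>+z. k z \<partial>distr lborel borel ((+) (-x)))"
      by (subst nn_integral_distr) auto
    also have "\<dots> = 1"
      unfolding lborel_distr_plus by (rule k1)
    finally show "(\<integral>\<^sup>+z. k (z - x) * F' x \<partial>lborel) = F' x" by simp
  qed
  also have "\<dots> = (\<integral>\<^sup>+x. F x \<partial>lebesgue)"
    unfolding nn_integral_completion by (intro nn_integral_cong_AE) (use ae in auto)
  finally show ?thesis .
qed

text \<open>The square of the positive part stands in for the positive part wherever a continuously differentiable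
  function is required: in the mollifier and in the test function of the comparison principle.\<close>

lemma DERIV_pos_part_square:
  "((\<lambda>t::real. (max 0 t)\<^sup>2) has_real_derivative 2 * max 0 t) (at t)"
proof -
  consider "t < 0" | "t > 0" | "t = 0" by linarith
  then show ?thesis
  proof cases
    case 1
    have "((\<lambda>t::real. 0) has_real_derivative 0) (at t)" by simp
    then have "((\<lambda>t::real. (max 0 t)\<^sup>2) has_real_derivative 0) (at t)"
      by (rule has_field_derivative_transform_within_open[of _ _ _ "{..<0}"]) (use 1 in auto)
    then show ?thesis using 1 by simp
  next
    case 2
    have "((\<lambda>t::real. t\<^sup>2) has_real_derivative 2 * t) (at t)"
      by (auto intro!: derivative_eq_intros)
    then have "((\<lambda>t::real. (max 0 t)\<^sup>2) has_real_derivative 2 * t) (at t)"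
      by (rule has_field_derivative_transform_within_open[of _ _ _ "{0<..}"]) (use 2 in auto)
    then show ?thesis using 2 by simp
  next
    case 3
    have "(\<lambda>h::real. (max 0 (0 + h))\<^sup>2 / h) \<midarrow>0\<rightarrow> 0"
    proof (rule Lim_null_comparison[where g="\<lambda>h. \<bar>h\<bar>"])
      show "\<forall>\<^sub>F h::real in at 0. norm ((max 0 (0 + h))\<^sup>2 / h) \<le> \<bar>h\<bar>"
        by (auto simp: max_def power2_eq_square)
    qed (auto intro!: tendsto_eq_intros)
    then show ?thesis using 3 by (simp add: DERIV_def)
  qed
qed

lemma uniformly_continuous_compact_support:
  fixes f :: "'a::euclidean_space \<Rightarrow> 'b::real_normed_vector"
  assumes f: "continuous_on UNIV f" and 0: "\<And>x. norm x \<ge> R \<Longrightarrow> f x = 0"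
  shows "uniformly_continuous_on UNIV f"
  unfolding uniformly_continuous_on_def
proof (intro allI impI)
  fix e :: real assume e: "0 < e"
  have "uniformly_continuous_on (cball 0 (R + 1)) f"
    by (intro compact_uniformly_continuous continuous_on_subset[OF f]) auto
  then obtain d where d: "d > 0"
    "\<And>x y. x \<in> cball 0 (R + 1) \<Longrightarrow> y \<in> cball 0 (R + 1) \<Longrightarrow> dist y x < d \<Longrightarrow> dist (f y) (f x) < e"
    using e unfolding uniformly_continuous_on_def by blast
  show "\<exists>d>0. \<forall>x\<in>UNIV. \<forall>y\<in>UNIV. dist y x < d \<longrightarrow> dist (f y) (f x) < e"
  proof (intro exI[of _ "min d 1"] conjI ballI impI)
    fix x y :: 'a assume xy: "dist y x < min d 1"
    show "dist (f y) (f x) < e"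
    proof (cases "norm x \<le> R + 1 \<and> norm y \<le> R + 1")
      case True then show ?thesis using d(2)[of x y] xy by auto
    next
      case False
      have "\<bar>norm x - norm y\<bar> < 1"
        using xy norm_triangle_ineq3[of x y] by (auto simp: dist_norm norm_minus_commute)
      then have "R \<le> norm x" "R \<le> norm y" using False by linarith+
      then show ?thesis using 0 e by simp
    qed
  qed (use d in auto)
qed

lemma continuous_compact_support_bounded:
  fixes f :: "'a::euclidean_space \<Rightarrow> 'b::real_normed_vector"
  assumes f: "continuous_on UNIV f" and 0: "\<And>x. norm x \<ge> R \<Longrightarrow> f x = 0"
  obtains B where "0 < B" "\<And>x. norm (f x) \<le> B"
proof -
  have "compact (f ` cball 0 R)"
    by (intro compact_continuous_image continuous_on_subset[OF f]) auto
  then obtain B where B: "0 < B" "\<And>x. x \<in> cball 0 R \<Longrightarrow> norm (f x) \<le> B"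
    using compact_imp_bounded[of "f ` cball 0 R"] by (auto simp: bounded_pos)
  have "norm (f x) \<le> B" for x
    using B 0[of x] by (cases "norm x \<le> R") auto
  then show ?thesis using B(1) that by blast
qed

lemma mollifier_kernel:
  fixes d :: real
  assumes "0 < d"
  obtains k :: "'a::euclidean_space \<Rightarrow> real" and Dk :: "'a \<Rightarrow> 'a"
  where "\<And>x. GDERIV k x :> Dk x" "continuous_on UNIV Dk" "\<And>x. 0 \<le> k x"
    "\<And>x. d \<le> norm x \<Longrightarrow> k x = 0" "\<And>x. d \<le> norm x \<Longrightarrow> Dk x = 0"
    "(\<integral>\<^sup>+x. ennreal (k x) \<partial>lborel) = 1"
proof -
  (* The square makes the truncated paraboloid continuously differentiable across its zero set. *)
  define f :: "'a \<Rightarrow> real" where "f x = (max 0 (d\<^sup>2 - x \<bullet> x))\<^sup>2" for x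
  have f0: "f x = 0" if "d \<le> norm x" for x
    using power_mono[OF that, of 2] assms by (auto simp: f_def power2_norm_eq_inner)
  have f_cont: "continuous_on UNIV f"
    unfolding f_def by (intro continuous_intros)
  then have fm[measurable]: "f \<in> borel_measurable borel"
    by (rule borel_measurable_continuous_onI)
  have f_le: "f x \<le> (d\<^sup>2)\<^sup>2" for x
    unfolding f_def by (intro power_mono) auto
  define Z where "Z = (\<integral>\<^sup>+x. ennreal (f x) \<partial>lborel)"
  have "Z \<le> (\<integral>\<^sup>+x. ennreal ((d\<^sup>2)\<^sup>2) * indicator (cball (0::'a) d) x \<partial>lborel)"
    unfolding Z_def
  proof (rule nn_integral_mono)
    fix x show "ennreal (f x) \<le> ennreal ((d\<^sup>2)\<^sup>2) * indicator (cball 0 d) x"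
      using f_le[of x] f0[of x] by (cases "norm x \<le> d") (auto split: split_indicator intro: ennreal_leI)
  qed
  also have "\<dots> = ennreal ((d\<^sup>2)\<^sup>2) * emeasure lborel (cball 0 d :: 'a set)"
    by (simp add: nn_integral_cmult_indicator)
  also have "\<dots> < \<infinity>"
    using emeasure_bounded_finite[of "cball (0::'a) d"] by (auto simp: ennreal_mult_less_top)
  finally have Zfin: "Z < \<infinity>" .
  have "Z \<noteq> 0"
  proof
    assume "Z = 0"
    then have "AE x in lborel. ennreal (f x) = 0"
      unfolding Z_def by (subst (asm) nn_integral_0_iff_AE) auto
    then have "AE x in lborel. x \<notin> ball (0::'a) d"
    proof (rule AE_mp, intro AE_I2 impI)
      fix x assume "ennreal (f x) = 0"
      then have "f x = 0" using f_def by (metis ennreal_eq_0_iff zero_le_power2 order_antisym)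
      then show "x \<notin> ball 0 d"
        using assms power_strict_mono[of "norm x" d 2] by (auto simp: f_def max_def power2_norm_eq_inner split: if_splits)
    qed
    then have "ball (0::'a) d \<in> null_sets lborel"
      by (subst (asm) AE_iff_null_sets[symmetric]) auto
    then have "negligible (ball (0::'a) d)"
      by (simp add: negligible_iff_null_sets null_sets_completionI)
    then show False
      using assms open_not_negligible[of "ball (0::'a) d"] by simp
  qed
  define c where "c = enn2real Z"
  have c: "0 < c" "Z = ennreal c"
    using Zfin \<open>Z \<noteq> 0\<close> by (auto simp: c_def enn2real_positive_iff less_top zero_less_iff_neq_zero)
  define k where "k x = f x / c" for x
  define Dk where "Dk x = (2 * max 0 (d\<^sup>2 - x \<bullet> x) / c) *\<^sub>R (- 2 *\<^sub>R x)" for x :: 'a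
  have g: "GDERIV (\<lambda>x. d\<^sup>2 - x \<bullet> x) x :> - 2 *\<^sub>R x" for x :: 'a
    unfolding gderiv_def by (auto intro!: derivative_eq_intros simp: inner_commute)
  show ?thesis
  proof (rule that[of k Dk])
    show "GDERIV k x :> Dk x" for x
    proof -
      have "DERIV (\<lambda>t. (max 0 t)\<^sup>2 / c) (d\<^sup>2 - x \<bullet> x) :> 2 * max 0 (d\<^sup>2 - x \<bullet> x) / c"
        by (rule DERIV_cdivide[OF DERIV_pos_part_square])
      from GDERIV_DERIV_compose[OF g this] show ?thesis
        by (simp only: k_def[abs_def] f_def Dk_def)
    qed
    show "continuous_on UNIV Dk"
      unfolding Dk_def by (intro continuous_intros) (use c in auto)
    show "0 \<le> k x" for x using c by (simp add: k_def f_def)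
    show "d \<le> norm x \<Longrightarrow> k x = 0" for x using f0 by (simp add: k_def)
    show "d \<le> norm x \<Longrightarrow> Dk x = 0" for x using f0[of x] by (simp add: Dk_def f_def)
    have "(\<integral>\<^sup>+x. ennreal (k x) \<partial>lborel) = (\<integral>\<^sup>+x. ennreal (f x) / ennreal c \<partial>lborel)"
      using c by (intro nn_integral_cong) (simp add: k_def f_def divide_ennreal)
    also have "\<dots> = Z / ennreal c"
      unfolding Z_def by (subst nn_integral_divide) auto
    also have "\<dots> = 1" using c by (simp add: divide_ennreal)
    finally show "(\<integral>\<^sup>+x. ennreal (k x) \<partial>lborel) = 1" .
  qed
qed

lemma kernel_integral_reflected:
  fixes k :: "'a::euclidean_space \<Rightarrow> real"
  assumes kc: "continuous_on UNIV k" and k0: "\<And>x. 0 \<le> k x" and k1: "(\<integral>\<^sup>+x. ennreal (k x) \<partial>lborel) = 1"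
  shows "(\<integral>x. k (z - x) \<partial>lebesgue) = 1"
proof -
  have [measurable]: "k \<in> borel_measurable borel"
    by (rule borel_measurable_continuous_onI[OF kc])
  have m: "(\<lambda>x. k (z - x)) \<in> borel_measurable lborel"
    by measurable
  have d: "distr lborel borel (\<lambda>x. z + (-1) *\<^sub>R x) = lborel"
    using lborel_affine[of "-1" z] by (simp add: density_1)
  have "(\<integral>x. k (z - x) \<partial>lebesgue) = (\<integral>x. k (z - x) \<partial>lborel)"
    by (rule integral_completion[OF m])
  also have "(\<integral>x. k (z - x) \<partial>lborel) = (\<integral>x. k x \<partial>distr lborel borel (\<lambda>x. z + (-1) *\<^sub>R x))"
    by (subst integral_distr) auto
  also have "\<dots> = enn2real (\<integral>\<^sup>+x. ennreal (k x) \<partial>lborel)"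
    unfolding d by (rule integral_eq_nn_integral) (use k0 in auto)
  finally show ?thesis by (simp add: k1)
qed

lemma kernel_average_deviation:
  fixes f :: "'a::euclidean_space \<Rightarrow> 'b::euclidean_space" and k :: "'a \<Rightarrow> real"
  assumes k: "integrable M k" "\<And>x. 0 \<le> k x" "(\<integral>x. k x \<partial>M) = 1"
    and f: "integrable M (\<lambda>x. k x *\<^sub>R f x)"
    and close: "\<And>x. x \<in> space M \<Longrightarrow> k x \<noteq> 0 \<Longrightarrow> norm (f x - c) \<le> e"
  shows "norm ((\<integral>x. k x *\<^sub>R f x \<partial>M) - c) \<le> e"
proof -
  have "(\<integral>x. k x *\<^sub>R f x \<partial>M) - c = (\<integral>x. k x *\<^sub>R f x \<partial>M) - (\<integral>x. k x *\<^sub>R c \<partial>M)"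
    using k by simp
  also have "\<dots> = (\<integral>x. k x *\<^sub>R (f x - c) \<partial>M)"
    using k f by (simp add: scaleR_diff_right)
  finally have eq: "(\<integral>x. k x *\<^sub>R f x \<partial>M) - c = (\<integral>x. k x *\<^sub>R (f x - c) \<partial>M)" .
  have "norm (\<integral>x. k x *\<^sub>R (f x - c) \<partial>M) \<le> (\<integral>x. e * k x \<partial>M)"
  proof (rule Bochner_Integration.integral_norm_bound_integral)
    show "integrable M (\<lambda>x. k x *\<^sub>R (f x - c))"
      using k f by (simp add: scaleR_diff_right)
    show "norm (k x *\<^sub>R (f x - c)) \<le> e * k x" if "x \<in> space M" for x
      using close[OF that] k(2)[of x] by (cases "k x = 0") (auto simp: mult.commute mult_right_mono)
  qed (use k in auto)
  also have "\<dots> = e" using k by simp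
  finally show ?thesis unfolding eq .
qed

lemma convolution_integrable:
  fixes K :: "'a::euclidean_space \<Rightarrow> 'b::euclidean_space" and v :: "'a \<Rightarrow> real"
  assumes K: "continuous_on UNIV K" "\<And>x. norm (K x) \<le> B" and v: "integrable lebesgue v"
  shows "integrable lebesgue (\<lambda>x. v x *\<^sub>R K (z - x))"
proof (rule Bochner_Integration.integrable_bound[where f="\<lambda>x. B *\<^sub>R v x"])
  have "continuous_on UNIV (\<lambda>x. K (z - x))"
    by (rule continuous_on_compose2[OF K(1)]) (auto intro!: continuous_intros)
  then have "(\<lambda>x. K (z - x)) \<in> borel_measurable lborel"
    by (simp add: borel_measurable_continuous_onI)
  then have [measurable]: "(\<lambda>x. K (z - x)) \<in> borel_measurable lebesgue"
    by (rule measurable_completion)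
  have [measurable]: "v \<in> borel_measurable lebesgue" using v by auto
  show "(\<lambda>x. v x *\<^sub>R K (z - x)) \<in> borel_measurable lebesgue" by measurable
  have "norm (v x *\<^sub>R K (z - x)) \<le> norm (B *\<^sub>R v x)" for x
  proof -
    have "0 \<le> B" using K(2)[of 0] norm_ge_zero order_trans by blast
    then show ?thesis using mult_right_mono[OF K(2)[of "z - x"], of "\<bar>v x\<bar>"] by (simp add: abs_mult mult.commute)
  qed
  then show "AE x in lebesgue. norm (v x *\<^sub>R K (z - x)) \<le> norm (B *\<^sub>R v x)" by simp
qed (use v in auto)

text \<open>The kernel is vector valued, so that the lemma serves the gradient of a mollifier as well as the
  mollifier itself.\<close>

lemma convolution_continuous:
  fixes K :: "'a::euclidean_space \<Rightarrow> 'b::euclidean_space" and v :: "'a \<Rightarrow> real"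
  assumes K: "uniformly_continuous_on UNIV K" "\<And>x. norm (K x) \<le> B" and v: "integrable lebesgue v"
  shows "continuous_on UNIV (\<lambda>z. \<integral>x. v x *\<^sub>R K (z - x) \<partial>lebesgue)"
proof -
  have int: "integrable lebesgue (\<lambda>x. v x *\<^sub>R K (z - x))" for z
    using uniformly_continuous_imp_continuous[OF K(1)] K(2) v by (rule convolution_integrable)
  define N where "N = (\<integral>x. \<bar>v x\<bar> \<partial>lebesgue) + 1"
  have N: "0 < N" unfolding N_def by (intro add_nonneg_pos Bochner_Integration.integral_nonneg) auto
  show ?thesis
    unfolding continuous_on_iff
  proof (intro ballI allI impI)
    fix z :: 'a and e :: real assume e: "0 < e"
    have "0 < e / N" using e N by simp
    then obtain d where d: "d > 0" "\<And>x y. dist y x < d \<Longrightarrow> dist (K y) (K x) < e / N"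
      using K(1) unfolding uniformly_continuous_on_def by (meson UNIV_I)
    show "\<exists>d>0. \<forall>z'\<in>UNIV. dist z' z < d \<longrightarrow>
        dist (\<integral>x. v x *\<^sub>R K (z' - x) \<partial>lebesgue) (\<integral>x. v x *\<^sub>R K (z - x) \<partial>lebesgue) < e"
    proof (intro exI[of _ d] conjI ballI impI)
      fix z' assume z': "dist z' z < d"
      have *: "norm (v x *\<^sub>R K (z' - x) - v x *\<^sub>R K (z - x)) \<le> e / N * \<bar>v x\<bar>" for x
      proof -
        have "norm (K (z' - x) - K (z - x)) \<le> e / N"
          using d(2)[of "z' - x" "z - x"] z' by (simp add: dist_norm)
        from mult_left_mono[OF this abs_ge_zero[of "v x"]] show ?thesis
          by (simp add: mult.commute flip: scaleR_diff_right)
      qed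
      have "dist (\<integral>x. v x *\<^sub>R K (z' - x) \<partial>lebesgue) (\<integral>x. v x *\<^sub>R K (z - x) \<partial>lebesgue)
          = norm (\<integral>x. v x *\<^sub>R K (z' - x) - v x *\<^sub>R K (z - x) \<partial>lebesgue)"
        using int by (simp add: dist_norm)
      also have "\<dots> \<le> (\<integral>x. e / N * \<bar>v x\<bar> \<partial>lebesgue)"
        by (rule Bochner_Integration.integral_norm_bound_integral) (use int v * in auto)
      also have "\<dots> = e / N * (N - 1)" by (simp add: N_def)
      also have "\<dots> < e" using e N by (simp add: field_simps)
      finally show "dist (\<integral>x. v x *\<^sub>R K (z' - x) \<partial>lebesgue) (\<integral>x. v x *\<^sub>R K (z - x) \<partial>lebesgue) < e" .
    qed (use d in auto)
  qed
qed

lemma GDERIV_linearization_bound: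
  fixes k :: "'a::euclidean_space \<Rightarrow> real"
  assumes k: "\<And>x. GDERIV k x :> Dk x"
    and D: "\<And>x. dist x a < d \<Longrightarrow> norm (Dk x - Dk a) \<le> e" and h: "norm h < d"
  shows "\<bar>k (a + h) - k a - h \<bullet> Dk a\<bar> \<le> norm h * e"
proof -
  have "norm (k (a + h) - k a - (a + h - a) \<bullet> Dk a) \<le> norm (a + h - a) * e"
  proof (rule differentiable_bound_linearization[where S="ball a d" and f'="\<lambda>x h. h \<bullet> Dk x" and ?x0.0=a])
    show "a + t *\<^sub>R (a + h - a) \<in> ball a d" if "t \<in> {0..1}" for t
    proof -
      have "\<bar>t\<bar> * norm h \<le> 1 * norm h" using that by (intro mult_right_mono) auto
      then show ?thesis using h by (simp add: dist_norm)
    qed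
    show "(k has_derivative (\<lambda>h. h \<bullet> Dk x)) (at x within ball a d)" for x
      using k[of x] unfolding gderiv_def by (rule has_derivative_at_withinI)
    show "onorm ((\<lambda>h. h \<bullet> Dk x) - (\<lambda>h. h \<bullet> Dk a)) \<le> e" if "x \<in> ball a d" for x
    proof (rule onorm_le)
      fix y
      have "norm (((\<lambda>h. h \<bullet> Dk x) - (\<lambda>h. h \<bullet> Dk a)) y) = \<bar>y \<bullet> (Dk x - Dk a)\<bar>"
        by (simp add: inner_diff_right)
      also have "\<dots> \<le> norm y * norm (Dk x - Dk a)" by (rule Cauchy_Schwarz_ineq2)
      also have "\<dots> \<le> norm y * e"
        using D[of x] that by (intro mult_left_mono) (auto simp: dist_commute)
      finally show "norm (((\<lambda>h. h \<bullet> Dk x) - (\<lambda>h. h \<bullet> Dk a)) y) \<le> e * norm y" by (simp add: mult.commute)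
    qed
    show "a \<in> ball a d" using h by (simp add: order.strict_trans1[OF norm_ge_zero])
  qed
  then show ?thesis by simp
qed

text \<open>The linearization error of the kernel is uniformly \<open>o(h)\<close> because its gradient is uniformly
  continuous; integrating it against \<open>v\<close> keeps it \<open>o(h)\<close>.\<close>

lemma GDERIV_convolution:
  fixes k :: "'a::euclidean_space \<Rightarrow> real" and v :: "'a \<Rightarrow> real"
  assumes k: "\<And>x. GDERIV k x :> Dk x" "\<And>x. norm (k x) \<le> B"
    and Dk: "uniformly_continuous_on UNIV Dk" "\<And>x. norm (Dk x) \<le> B" and v: "integrable lebesgue v"
  shows "GDERIV (\<lambda>z. \<integral>x. v x * k (z - x) \<partial>lebesgue) z :> (\<integral>x. v x *\<^sub>R Dk (z - x) \<partial>lebesgue)"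
proof -
  have kc: "continuous_on UNIV k"
    using k(1) unfolding gderiv_def by (meson continuous_at_imp_continuous_on has_derivative_continuous)
  have intk: "integrable lebesgue (\<lambda>x. v x * k (z - x))" for z
    using convolution_integrable[OF kc k(2) v] by simp
  have intD: "integrable lebesgue (\<lambda>x. v x *\<^sub>R Dk (z - x))" for z
    using uniformly_continuous_imp_continuous[OF Dk(1)] Dk(2) v by (rule convolution_integrable)
  define N where "N = (\<integral>x. \<bar>v x\<bar> \<partial>lebesgue) + 1"
  have N: "0 < N" unfolding N_def by (intro add_nonneg_pos Bochner_Integration.integral_nonneg) auto
  show ?thesis
    unfolding gderiv_def has_derivative_at_alt
  proof (intro conjI allI impI)
    show "bounded_linear (\<lambda>h. h \<bullet> (\<integral>x. v x *\<^sub>R Dk (z - x) \<partial>lebesgue))"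
      by (rule bounded_linear_inner_left)
    fix e :: real assume e: "0 < e"
    have "0 < e / N" using e N by simp
    then obtain d where d: "d > 0" "\<And>x y. dist y x < d \<Longrightarrow> dist (Dk y) (Dk x) < e / N"
      using Dk(1) unfolding uniformly_continuous_on_def by (meson UNIV_I)
    show "\<exists>d>0. \<forall>y. norm (y - z) < d \<longrightarrow>
        norm ((\<integral>x. v x * k (y - x) \<partial>lebesgue) - (\<integral>x. v x * k (z - x) \<partial>lebesgue) -
          (y - z) \<bullet> (\<integral>x. v x *\<^sub>R Dk (z - x) \<partial>lebesgue)) \<le> e * norm (y - z)"
    proof (intro exI[of _ d] conjI allI impI)
      fix y assume y: "norm (y - z) < d"
      let ?h = "y - z"
      have *: "norm (v x * k (y - x) - v x * k (z - x) - ?h \<bullet> (v x *\<^sub>R Dk (z - x))) \<le> norm ?h * (e / N) * \<bar>v x\<bar>" for x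
      proof -
        have "\<bar>k ((z - x) + ?h) - k (z - x) - ?h \<bullet> Dk (z - x)\<bar> \<le> norm ?h * (e / N)"
          by (rule GDERIV_linearization_bound[OF k(1) _ y]) (use d(2) in \<open>force simp: dist_norm\<close>)
        from mult_left_mono[OF this abs_ge_zero[of "v x"]] show ?thesis
          by (simp add: algebra_simps flip: abs_mult)
      qed
      have "(\<integral>x. v x * k (y - x) \<partial>lebesgue) - (\<integral>x. v x * k (z - x) \<partial>lebesgue) -
          ?h \<bullet> (\<integral>x. v x *\<^sub>R Dk (z - x) \<partial>lebesgue)
        = (\<integral>x. v x * k (y - x) - v x * k (z - x) - ?h \<bullet> (v x *\<^sub>R Dk (z - x)) \<partial>lebesgue)"
        using intk intD by (simp del: inner_scaleR_right)
      also have "norm \<dots> \<le> (\<integral>x. norm ?h * (e / N) * \<bar>v x\<bar> \<partial>lebesgue)"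
        by (rule Bochner_Integration.integral_norm_bound_integral) (use intk intD v * in \<open>auto simp del: inner_scaleR_right\<close>)
      also have "\<dots> = norm ?h * (e / N) * (N - 1)" by (simp add: N_def)
      also have "\<dots> \<le> e * norm ?h" using e N by (simp add: field_simps)
      finally show "norm ((\<integral>x. v x * k (y - x) \<partial>lebesgue) - (\<integral>x. v x * k (z - x) \<partial>lebesgue) -
          ?h \<bullet> (\<integral>x. v x *\<^sub>R Dk (z - x) \<partial>lebesgue)) \<le> e * norm ?h" .
    qed (use d in auto)
  qed
qed

section \<open>Approximation of Sobolev functions\<close>

lemma compact_neighbourhood:
  fixes C :: "'a::euclidean_space set"
  assumes "compact C" "open S" "C \<subseteq> S"
  obtains d C' where "0 < d" "compact C'" "C \<subseteq> C'" "C' \<subseteq> S" "\<And>z. z \<in> C \<Longrightarrow> cball z d \<subseteq> C'"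
proof -
  obtain e where e: "e > 0" "(\<Union>x\<in>C. cball x e) \<subseteq> S"
    using compact_subset_open_imp_cball_epsilon_subset[OF assms] by blast
  have eq: "(\<Union>x\<in>C. cball x e) = {x + y |x y. x \<in> C \<and> y \<in> cball 0 e}"
  proof (intro set_eqI iffI)
    fix z assume "z \<in> (\<Union>x\<in>C. cball x e)"
    then obtain x where "x \<in> C" "dist x z \<le> e" by auto
    then show "z \<in> {x + y |x y. x \<in> C \<and> y \<in> cball 0 e}"
      by (intro CollectI exI[of _ x] exI[of _ "z - x"]) (auto simp: dist_norm norm_minus_commute)
  next
    fix z assume "z \<in> {x + y |x y. x \<in> C \<and> y \<in> cball 0 e}"
    then obtain x y where "z = x + y" "x \<in> C" "norm y \<le> e" by auto
    then show "z \<in> (\<Union>x\<in>C. cball x e)" by (intro UN_I[of x]) (auto simp: dist_norm)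
  qed
  have "compact (\<Union>x\<in>C. cball x e)"
    unfolding eq by (intro compact_sums assms compact_cball)
  then show ?thesis using e by (intro that[of e "\<Union>x\<in>C. cball x e"]) auto
qed

text \<open>Mollification. The functions converge uniformly because \<open>u\<close> is continuous. For the
  gradients, \<open>G\<close> is first replaced by a continuous function \<open>g\<close> that is close
  in \<open>L\<^sup>p\<close>: mollifying \<open>g\<close> moves it by its modulus of continuity, and
  mollifying \<open>G - g\<close> does not increase its norm, by Jensen's inequality and Tonelli's
  theorem.\<close>

lemma Sobolev_local_C1_approx:
  fixes \<Omega> C :: "'a::euclidean_space set"
  assumes \<Omega>: "open \<Omega>" and C: "compact C" "C \<subseteq> \<Omega>" and uc: "continuous_on \<Omega> u"
    and W: "W1p_loc p \<Omega> u G" and p: "1 < p" and e: "0 < e"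
  obtains U D where "\<And>x. GDERIV U x :> D x" "continuous_on UNIV D" "\<And>x. x \<in> C \<Longrightarrow> \<bar>U x - u x\<bar> \<le> e"
    "integrable (lebesgue_on C) (\<lambda>x. norm (G x - D x) powr p)"
    "(\<integral>x. norm (G x - D x) powr p \<partial>lebesgue_on C) \<le> e"
proof -
  obtain d C' where d: "0 < d" and C': "compact C'" "C \<subseteq> C'" "C' \<subseteq> \<Omega>" and dC: "\<And>z. z \<in> C \<Longrightarrow> cball z d \<subseteq> C'"
    using compact_neighbourhood[OF C(1) \<Omega> C(2)] by blast
  have [simp]: "C' \<in> sets lebesgue" "C \<in> sets lebesgue" "\<Omega> \<in> sets lebesgue"
    using C C' \<Omega> by (auto intro: compact_in_sets_lebesgue borel_open)
  interpret C': finite_measure "lebesgue_on C'"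
    by (rule finite_measure_lebesgue_on_compact[OF C'(1)])
  interpret C: finite_measure "lebesgue_on C"
    by (rule finite_measure_lebesgue_on_compact[OF C(1)])
  have G\<Omega>: "G \<in> borel_measurable (lebesgue_on \<Omega>)" and Gp: "integrable (lebesgue_on C') (\<lambda>x. norm (G x) powr p)"
    and wg: "weak_gradient \<Omega> u G"
    using W C' unfolding W1p_loc_def Lp_loc_def by auto
  have Gm[measurable]: "G \<in> borel_measurable (lebesgue_on C')"
    by (rule measurable_restrict_mono[OF G\<Omega> C'(3)])
  have GmC[measurable]: "G \<in> borel_measurable (lebesgue_on C)"
    by (rule measurable_restrict_mono[OF Gm C'(2)])
  (* A and B are the coefficients of e1, the L^p error of g, and of e2 powr p, the oscillation of g, in the
     final estimate; each of the two terms receives half of e. *)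
  define \<mu> where "\<mu> = measure (lebesgue_on C) (space (lebesgue_on C))"
  define A where "A = 2 powr p + 2 powr p * 2 powr p"
  define B where "B = 2 powr p * 2 powr p * \<mu>"
  have AB: "0 < A" "0 \<le> B" by (auto simp: A_def B_def \<mu>_def add_pos_pos)
  define e1 where "e1 = e / (2 * A)"
  define e2 where "e2 = (e / (2 * (B + 1))) powr (1 / p)"
  have e12: "0 < e1" "0 < e2" "A * e1 = e / 2" "B * e2 powr p \<le> e / 2"
    using e AB p by (auto simp: e1_def e2_def powr_powr field_simps)
  obtain g where g: "continuous_on UNIV g" and intE: "integrable (lebesgue_on C') (\<lambda>x. norm (G x - g x) powr p)"
    and smallE: "(\<integral>x. norm (G x - g x) powr p \<partial>lebesgue_on C') < e1"
    using Lp_continuous_approx[OF C'(1) Gm Gp _ e12(1)] p by auto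
  have ucs: "uniformly_continuous_on C' u" "uniformly_continuous_on C' g"
    using C' uc g by (auto intro!: compact_uniformly_continuous intro: continuous_on_subset)
  obtain d1 where d1: "d1 > 0" "\<And>x y. x \<in> C' \<Longrightarrow> y \<in> C' \<Longrightarrow> dist y x < d1 \<Longrightarrow> dist (u y) (u x) < e"
    using ucs(1) e unfolding uniformly_continuous_on_def by blast
  obtain d2 where d2: "d2 > 0" "\<And>x y. x \<in> C' \<Longrightarrow> y \<in> C' \<Longrightarrow> dist y x < d2 \<Longrightarrow> dist (g y) (g x) < e2"
    using ucs(2) e12(2) unfolding uniformly_continuous_on_def by blast
  define r where "r = min d (min d1 d2)"
  have r: "0 < r" "r \<le> d" "r \<le> d1" "r \<le> d2" using d d1 d2 by (auto simp: r_def)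
  obtain k :: "'a \<Rightarrow> real" and Dk where k: "\<And>x. GDERIV k x :> Dk x" and Dkc: "continuous_on UNIV Dk" and k0: "\<And>x. 0 \<le> k x"
    and kz: "\<And>x. r \<le> norm x \<Longrightarrow> k x = 0" and Dkz: "\<And>x. r \<le> norm x \<Longrightarrow> Dk x = 0"
    and k1: "(\<integral>\<^sup>+x. ennreal (k x) \<partial>lborel) = 1"
    by (rule mollifier_kernel[OF r(1), where 'a='a]) blast
  have kc: "continuous_on UNIV k"
    using k unfolding gderiv_def by (meson continuous_at_imp_continuous_on has_derivative_continuous)
  have kuc: "uniformly_continuous_on UNIV k" and Dkuc: "uniformly_continuous_on UNIV Dk"
    using uniformly_continuous_compact_support[OF kc kz] uniformly_continuous_compact_support[OF Dkc Dkz] by auto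
  obtain B1 where "0 < B1" and B1: "\<And>x. norm (k x) \<le> B1"
    using continuous_compact_support_bounded[of k r] kc kz by blast
  obtain B2 where "0 < B2" and B2: "\<And>x. norm (Dk x) \<le> B2"
    using continuous_compact_support_bounded[of Dk r] Dkc Dkz by blast
  define Bk where "Bk = max B1 B2"
  have kB: "norm (k x) \<le> Bk" and DkB: "norm (Dk x) \<le> Bk" for x
    using B1[of x] B2[of x] by (simp_all add: Bk_def)
  have km[measurable]: "(\<lambda>x. k (z - x)) \<in> borel_measurable (lebesgue_on S)" if "S \<in> sets lebesgue" for z S
    using that by (intro continuous_imp_measurable_on_sets_lebesgue continuous_on_compose2[OF kc] continuous_intros) auto
  define v where "v x = (if x \<in> C' then u x else 0)" for x
  have uint: "integrable (lebesgue_on C') u"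
  proof -
    have "continuous_on C' u" by (rule continuous_on_subset[OF uc C'(3)])
    then obtain M where "\<And>x. x \<in> C' \<Longrightarrow> norm (u x) \<le> M"
      using compact_imp_bounded[OF compact_continuous_image[of C' u]] C'(1) by (auto simp: bounded_iff)
    moreover have "u \<in> borel_measurable (lebesgue_on C')"
      by (rule continuous_imp_measurable_on_sets_lebesgue) (use \<open>continuous_on C' u\<close> in auto)
    ultimately show ?thesis
      by (intro C'.integrable_const_bound[where B=M] AE_I2) auto
  qed
  then have v: "integrable lebesgue v"
    unfolding v_def by (subst Lebesgue_Measure.integrable_restrict_UNIV) auto
  define U where "U z = (\<integral>x. v x * k (z - x) \<partial>lebesgue)" for z
  define D where "D z = (\<integral>x. v x *\<^sub>R Dk (z - x) \<partial>lebesgue)" for z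
  have UD: "GDERIV U z :> D z" for z
    unfolding U_def[abs_def] D_def by (rule GDERIV_convolution[OF k kB Dkuc DkB v])
  have Dc: "continuous_on UNIV D"
    unfolding D_def[abs_def] by (rule convolution_continuous[OF Dkuc DkB v])
  have kdist: "dist z x < r" if "k (z - x) \<noteq> 0" for z x
    using kz[of "z - x"] that unfolding dist_norm by linarith
  have near: "x \<in> C'" if "z \<in> C" "k (z - x) \<noteq> 0" for z x
    using subsetD[OF dC[OF that(1)], of x] kdist[OF that(2)] r(2) by simp
  have kint: "integrable (lebesgue_on C') (\<lambda>x. k (z - x))" for z
    by (rule C'.integrable_const_bound[where B=Bk]) (simp_all add: kB[unfolded real_norm_def] km)
  have kprob: "(\<integral>x. k (z - x) \<partial>lebesgue_on C') = 1" if z: "z \<in> C" for z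
  proof -
    have "(\<integral>x. k (z - x) \<partial>lebesgue_on C') = (\<integral>x. k (z - x) \<partial>lebesgue)"
      by (rule integral_lebesgue_restrict[symmetric]) (use near[OF z] in \<open>simp, blast\<close>)
    then show ?thesis using kernel_integral_reflected[OF kc k0 k1] by simp
  qed
  have kfint: "integrable (lebesgue_on C') (\<lambda>x. k (z - x) *\<^sub>R f x)" if "integrable (lebesgue_on C') f"
    for z and f :: "'a \<Rightarrow> 'b::euclidean_space"
  proof (rule Bochner_Integration.integrable_bound[where f="\<lambda>x. Bk *\<^sub>R f x"])
    show "AE x in lebesgue_on C'. norm (k (z - x) *\<^sub>R f x) \<le> norm (Bk *\<^sub>R f x)"
    proof (intro AE_I2)
      fix x
      have "norm (k (z - x)) * norm (f x) \<le> \<bar>Bk\<bar> * norm (f x)"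
        using kB[of "z - x"] abs_ge_self[of Bk] by (intro mult_right_mono) (linarith, simp)
      then show "norm (k (z - x) *\<^sub>R f x) \<le> norm (Bk *\<^sub>R f x)" by simp
    qed
    show "(\<lambda>x. k (z - x) *\<^sub>R f x) \<in> borel_measurable (lebesgue_on C')"
      by (rule borel_measurable_scaleR[OF km borel_measurable_integrable[OF that]]) simp
  qed (rule integrable_scaleR_right, rule that)
  have UC: "\<bar>U z - u z\<bar> \<le> e" if z: "z \<in> C" for z
  proof -
    have "U z = (\<integral>x. v x * k (z - x) \<partial>lebesgue_on C')"
      unfolding U_def by (rule integral_lebesgue_restrict) (simp_all add: v_def)
    also have "\<dots> = (\<integral>x. k (z - x) *\<^sub>R u x \<partial>lebesgue_on C')"
      by (rule Bochner_Integration.integral_cong) (simp_all add: v_def)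
    finally have "U z = (\<integral>x. k (z - x) *\<^sub>R u x \<partial>lebesgue_on C')" .
    moreover have "norm ((\<integral>x. k (z - x) *\<^sub>R u x \<partial>lebesgue_on C') - u z) \<le> e"
    proof (rule kernel_average_deviation)
      fix x assume x: "x \<in> space (lebesgue_on C')" "k (z - x) \<noteq> 0"
      have "dist (u x) (u z) < e"
        by (rule d1(2)) (use x z C' r kdist[OF x(2)] in \<open>auto simp: dist_commute\<close>)
      then show "norm (u x - u z) \<le> e" by (simp add: dist_norm)
    qed (rule kint, rule k0, rule kprob[OF z], rule kfint[OF uint])
    ultimately show ?thesis by simp
  qed
  have gintC': "integrable (lebesgue_on C') g"
  proof -
    obtain M where "\<And>x. x \<in> C' \<Longrightarrow> norm (g x) \<le> M"
      using compact_imp_bounded[OF compact_continuous_image[of C' g]] C'(1) continuous_on_subset[OF g] by (auto simp: bounded_iff)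
    moreover have "g \<in> borel_measurable (lebesgue_on C')"
      by (rule continuous_imp_measurable_on_sets_lebesgue) (use continuous_on_subset[OF g] in auto)
    ultimately show ?thesis
      by (intro C'.integrable_const_bound[where B=M] AE_I2) auto
  qed
  have Gint: "integrable (lebesgue_on C') G"
    using p by (intro integrable_of_powr[OF _ Gm Gp]) (auto intro: C'.finite_measure_axioms)
  (* Testing the weak gradient with the kernel centred at z turns the gradient of the mollified
     function into the mollified gradient, as long as the support of the kernel stays in C'. *)
  have DC: "D z = (\<integral>x. k (z - x) *\<^sub>R G x \<partial>lebesgue_on C')" if z: "z \<in> C" for z
  proof -
    let ?f = "\<lambda>x. k (z - x)" and ?D = "\<lambda>x. - Dk (z - x)"
    have supp: "closure {x. ?f x \<noteq> 0} \<subseteq> cball z r"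
    proof (rule closure_minimal)
      show "{x. k (z - x) \<noteq> 0} \<subseteq> cball z r"
      proof
        fix x assume "x \<in> {x. k (z - x) \<noteq> 0}"
        then show "x \<in> cball z r" using kdist[of z x] by simp
      qed
    qed simp
    have "C01_test \<Omega> ?f ?D"
      unfolding C01_test_def
    proof (intro conjI allI)
      fix x
      have "((\<lambda>x. z - x) has_derivative (\<lambda>h. - h)) (at x)"
        by (auto intro!: derivative_eq_intros)
      from has_derivative_compose[OF this k[of "z - x", unfolded gderiv_def]]
      show "GDERIV ?f x :> ?D x"
        unfolding gderiv_def by simp
      show "continuous_on UNIV ?D"
        by (intro continuous_intros continuous_on_compose2[OF Dkc]) auto
      show "compact (closure {x. ?f x \<noteq> 0})"
        using bounded_subset[OF bounded_cball supp] by (simp add: compact_eq_bounded_closed)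
      show "closure {x. ?f x \<noteq> 0} \<subseteq> \<Omega>"
        using supp subset_cball[OF r(2), of z] dC[OF z] C'(3) by blast
    qed
    then have *: "(\<integral>x. u x *\<^sub>R ?D x \<partial>lebesgue_on \<Omega>) = - (\<integral>x. ?f x *\<^sub>R G x \<partial>lebesgue_on \<Omega>)"
      using wg unfolding weak_gradient_def by blast
    have D0: "Dk (z - x) = 0" if "x \<notin> C'" for x
    proof (rule Dkz, rule ccontr)
      assume "\<not> r \<le> norm (z - x)"
      then have "x \<in> cball z d" using r by (simp add: dist_norm)
      then show False using dC[OF z] that by auto
    qed
    have "D z = (\<integral>x. v x *\<^sub>R Dk (z - x) \<partial>lebesgue_on C')"
      unfolding D_def by (rule integral_lebesgue_restrict) (simp_all add: v_def)
    also have "\<dots> = (\<integral>x. - (u x *\<^sub>R ?D x) \<partial>lebesgue_on C')"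
      by (rule Bochner_Integration.integral_cong) (simp_all add: v_def)
    also have "\<dots> = - (\<integral>x. u x *\<^sub>R ?D x \<partial>lebesgue_on C')"
      by (rule Bochner_Integration.integral_minus)
    also have "(\<integral>x. u x *\<^sub>R ?D x \<partial>lebesgue_on C') = (\<integral>x. u x *\<^sub>R ?D x \<partial>lebesgue_on \<Omega>)"
      by (rule integral_lebesgue_on_extend[symmetric]) (use C' D0 in auto)
    also have "- \<dots> = (\<integral>x. ?f x *\<^sub>R G x \<partial>lebesgue_on \<Omega>)" using * by simp
    also have "\<dots> = (\<integral>x. ?f x *\<^sub>R G x \<partial>lebesgue_on C')"
      by (rule integral_lebesgue_on_extend) (use C'(3) near[OF z] in \<open>simp, simp, simp, fastforce\<close>)
    finally show ?thesis .
  qed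
  (* J is the mollification of the p-th power of G - g; it bounds the p-th power of the mollified G - g,
     and mollifying does not increase the integral. *)
  define J where "J z = (\<integral>x. k (z - x) * norm (G x - g x) powr p \<partial>lebesgue_on C')" for z
  define F where "F x = (if x \<in> C' then norm (G x - g x) powr p else 0)" for x
  have F: "integrable lebesgue F"
    unfolding F_def using intE by (subst Lebesgue_Measure.integrable_restrict_UNIV) auto
  have JF: "J z = (\<integral>x. F x *\<^sub>R k (z - x) \<partial>lebesgue)" for z
  proof -
    have "(\<integral>x. F x *\<^sub>R k (z - x) \<partial>lebesgue) = (\<integral>x. F x *\<^sub>R k (z - x) \<partial>lebesgue_on C')"
      by (rule integral_lebesgue_restrict) (simp_all add: F_def)
    also have "\<dots> = J z" unfolding J_def
      by (rule Bochner_Integration.integral_cong) (simp_all add: F_def)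
    finally show ?thesis ..
  qed
  have Jc: "continuous_on UNIV J"
    unfolding JF[abs_def] by (rule convolution_continuous[OF kuc kB F])
  have J0: "0 \<le> J z" for z
    unfolding J_def using k0 by (intro Bochner_Integration.integral_nonneg) auto
  have F0: "0 \<le> F x" for x by (simp add: F_def)
  have intJ: "integrable (lebesgue_on C) J" and Jle: "(\<integral>z. J z \<partial>lebesgue_on C) \<le> e1"
  proof -
    have Jm: "J \<in> borel_measurable (lebesgue_on C)"
      by (rule continuous_imp_measurable_on_sets_lebesgue) (use continuous_on_subset[OF Jc] in auto)
    have "(\<integral>\<^sup>+z. ennreal (J z) \<partial>lebesgue_on C) \<le> (\<integral>\<^sup>+z. ennreal (J z) \<partial>lebesgue)"
      by (subst nn_integral_restrict_space) (auto intro!: nn_integral_mono simp: indicator_def)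
    also have "\<dots> = (\<integral>\<^sup>+z. (\<integral>\<^sup>+x. ennreal (k (z - x)) * ennreal (F x) \<partial>lebesgue) \<partial>lebesgue)"
    proof (rule nn_integral_cong)
      fix z
      have "integrable lebesgue (\<lambda>x. F x *\<^sub>R k (z - x))"
        by (rule convolution_integrable[OF kc kB F])
      then have "ennreal (J z) = (\<integral>\<^sup>+x. ennreal (F x *\<^sub>R k (z - x)) \<partial>lebesgue)"
        unfolding JF using F0 k0 by (subst nn_integral_eq_integral) auto
      then show "ennreal (J z) = (\<integral>\<^sup>+x. ennreal (k (z - x)) * ennreal (F x) \<partial>lebesgue)"
        using F0 k0 by (simp add: ennreal_mult' mult.commute)
    qed
    also have "\<dots> = (\<integral>\<^sup>+x. ennreal (F x) \<partial>lebesgue)"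
      using F k1 borel_measurable_continuous_onI[OF kc] by (intro nn_integral_lebesgue_convolution) simp_all
    also have "\<dots> = ennreal (\<integral>x. F x \<partial>lebesgue)"
      using F F0 by (intro nn_integral_eq_integral) auto
    also have "(\<integral>x. F x \<partial>lebesgue) = (\<integral>x. norm (G x - g x) powr p \<partial>lebesgue_on C')"
      unfolding F_def by (rule Lebesgue_Measure.integral_restrict_UNIV) simp
    also have "ennreal \<dots> \<le> ennreal e1" using smallE by (intro ennreal_leI) simp
    finally have *: "(\<integral>\<^sup>+z. ennreal (J z) \<partial>lebesgue_on C) \<le> ennreal e1" .
    then have "(\<integral>\<^sup>+z. ennreal (J z) \<partial>lebesgue_on C) < \<infinity>"
      using ennreal_less_top le_less_trans by (metis infinity_ennreal_def)
    then show i: "integrable (lebesgue_on C) J"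
      using Jm J0 by (intro integrableI_bounded) auto
    then have "ennreal (\<integral>z. J z \<partial>lebesgue_on C) \<le> ennreal e1"
      using * J0 by (subst (asm) nn_integral_eq_integral) auto
    then show "(\<integral>z. J z \<partial>lebesgue_on C) \<le> e1" using e12 by simp
  qed
  (* G - D is (G - g), minus its mollification ?I, plus the mollification error g - ?Ig of the
     uniformly continuous function g. *)
  have pw: "norm (G z - D z) powr p
      \<le> 2 powr p * (norm (G z - g z) powr p + 2 powr p * (J z + e2 powr p))" if z: "z \<in> C" for z
  proof -
    let ?I = "\<integral>x. k (z - x) *\<^sub>R (G x - g x) \<partial>lebesgue_on C'"
    let ?Ig = "\<integral>x. k (z - x) *\<^sub>R g x \<partial>lebesgue_on C'"
    have Ig: "norm (?Ig - g z) \<le> e2"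
    proof (rule kernel_average_deviation)
      fix x assume x: "x \<in> space (lebesgue_on C')" "k (z - x) \<noteq> 0"
      have "dist (g x) (g z) < e2"
        by (rule d2(2)) (use x z C' r kdist[OF x(2)] in \<open>auto simp: dist_commute\<close>)
      then show "norm (g x - g z) \<le> e2" by (simp add: dist_norm)
    qed (rule kint, rule k0, rule kprob[OF z], rule kfint[OF gintC'])
    have intEn: "integrable (lebesgue_on C') (\<lambda>x. norm (G x - g x))"
      using Gint gintC' by auto
    have "norm ?I \<le> (\<integral>x. k (z - x) * norm (G x - g x) \<partial>lebesgue_on C')"
      using integral_norm_bound[of "lebesgue_on C'" "\<lambda>x. k (z - x) *\<^sub>R (G x - g x)"] k0 by simp
    then have "norm ?I powr p \<le> (\<integral>x. k (z - x) * norm (G x - g x) \<partial>lebesgue_on C') powr p"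
      using p by (intro powr_mono2) auto
    also have "\<dots> \<le> J z"
      unfolding J_def using kint k0 kprob[OF z] kfint[OF intEn, of z] kfint[OF intE, of z]
      by (intro Jensen_powr p) simp_all
    finally have I: "norm ?I powr p \<le> J z" .
    have "D z = ?I + ?Ig"
      unfolding DC[OF z] using kfint[OF Gint] kfint[OF gintC'] by (simp add: scaleR_diff_right)
    then have eq: "G z - D z = (G z - g z) + (- ?I + (g z - ?Ig))" by simp
    have "norm (g z - ?Ig) powr p \<le> e2 powr p"
      using Ig p by (intro powr_mono2) (auto simp: norm_minus_commute)
    then have "norm (- ?I + (g z - ?Ig)) powr p \<le> 2 powr p * (J z + e2 powr p)"
      using powr_norm_add_le[of p "- ?I" "g z - ?Ig"] I p
      by (smt (verit) mult_left_mono norm_minus_cancel powr_ge_zero)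
    then show ?thesis
      unfolding eq using powr_norm_add_le[of p "G z - g z" "- ?I + (g z - ?Ig)"] p
      by (smt (verit) mult_left_mono powr_ge_zero)
  qed
  have intEC: "integrable (lebesgue_on C) (\<lambda>x. norm (G x - g x) powr p)"
    by (rule lebesgue_on_mono_integrable[OF intE]) (use C' in auto)
  let ?R = "\<lambda>z. 2 powr p * (norm (G z - g z) powr p + 2 powr p * (J z + e2 powr p))"
  have intR: "integrable (lebesgue_on C) ?R"
    using intEC intJ by auto
  have Dm: "D \<in> borel_measurable (lebesgue_on C)"
    by (rule continuous_imp_measurable_on_sets_lebesgue) (use continuous_on_subset[OF Dc] in auto)
  have intD: "integrable (lebesgue_on C) (\<lambda>x. norm (G x - D x) powr p)"
  proof (rule Bochner_Integration.integrable_bound[OF intR])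
    show "AE x in lebesgue_on C. norm (norm (G x - D x) powr p) \<le> norm (?R x)"
      using pw by (intro AE_I2) (fastforce simp: space_restrict_space)
  qed (use Dm in measurable)
  have "(\<integral>x. norm (G x - D x) powr p \<partial>lebesgue_on C) \<le> (\<integral>z. ?R z \<partial>lebesgue_on C)"
    by (rule integral_mono[OF intD intR]) (use pw in \<open>auto simp: space_restrict_space\<close>)
  also have "\<dots> = 2 powr p * ((\<integral>z. norm (G z - g z) powr p \<partial>lebesgue_on C)
      + 2 powr p * ((\<integral>z. J z \<partial>lebesgue_on C) + e2 powr p * \<mu>))"
    using intEC intJ by (simp add: \<mu>_def)
  also have "\<dots> \<le> 2 powr p * (e1 + 2 powr p * (e1 + e2 powr p * \<mu>))"
  proof -
    have "(\<integral>z. norm (G z - g z) powr p \<partial>lebesgue_on C) \<le> (\<integral>z. norm (G z - g z) powr p \<partial>lebesgue_on C')"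
    proof -
      have "(\<integral>z. norm (G z - g z) powr p \<partial>lebesgue_on C) = (\<integral>z. (if z \<in> C then norm (G z - g z) powr p else 0) \<partial>lebesgue)"
        by (rule Lebesgue_Measure.integral_restrict_UNIV[symmetric]) simp
      also have "\<dots> \<le> (\<integral>z. (if z \<in> C' then norm (G z - g z) powr p else 0) \<partial>lebesgue)"
        using intE intEC C' by (intro integral_mono) (auto simp: Lebesgue_Measure.integrable_restrict_UNIV)
      also have "\<dots> = (\<integral>z. norm (G z - g z) powr p \<partial>lebesgue_on C')"
        by (rule Lebesgue_Measure.integral_restrict_UNIV) simp
      finally show ?thesis .
    qed
    then show ?thesis using smallE Jle by (intro mult_left_mono add_mono) auto
  qed
  also have "\<dots> = A * e1 + B * e2 powr p"
    by (simp add: A_def B_def algebra_simps)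
  also have "\<dots> \<le> e" using e12 by simp
  finally have "(\<integral>x. norm (G x - D x) powr p \<partial>lebesgue_on C) \<le> e" .
  then show ?thesis
    using that[of U D] UD Dc UC intD by blast
qed

section \<open>The comparison principle\<close>

text \<open>The vector field whose divergence, at the gradient of a function, is its \<open>p\<close>-Laplacian.\<close>

definition p_flux :: "real \<Rightarrow> 'a::euclidean_space \<Rightarrow> 'a" where
  "p_flux p a = norm a powr (p - 2) *\<^sub>R a"

lemma p_flux_measurable [measurable]: "p_flux p \<in> borel_measurable borel"
  unfolding p_flux_def[abs_def] by measurable

lemma norm_p_flux: "2 \<le> p \<Longrightarrow> norm (p_flux p a) = norm a powr (p - 1)"
  using powr_mult_base[of "norm a" "p - 2"] by (simp add: p_flux_def mult.commute)

text \<open>Cauchy-Schwarz reduces the claim to the one-dimensional fact that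
  \<open>t \<mapsto> t powr (p - 1)\<close> is increasing.\<close>

lemma p_flux_monotone:
  assumes p: "2 \<le> p"
  shows "0 \<le> (p_flux p a - p_flux p b) \<bullet> (a - b)"
proof -
  let ?s = "norm a powr (p - 2)" and ?t = "norm b powr (p - 2)"
  have "a \<bullet> b \<le> norm a * norm b" by (rule norm_cauchy_schwarz)
  then have "(?s + ?t) * (a \<bullet> b) \<le> (?s + ?t) * (norm a * norm b)"
    by (intro mult_left_mono) auto
  then have "(p_flux p a - p_flux p b) \<bullet> (a - b) \<ge> ?s * (norm a)\<^sup>2 + ?t * (norm b)\<^sup>2 - (?s + ?t) * (norm a * norm b)"
    by (simp add: p_flux_def inner_diff_left inner_diff_right inner_commute algebra_simps power2_norm_eq_inner)
  also have "?s * (norm a)\<^sup>2 + ?t * (norm b)\<^sup>2 - (?s + ?t) * (norm a * norm b)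
      = (norm a * ?s - norm b * ?t) * (norm a - norm b)"
    by (simp add: algebra_simps power2_eq_square)
  finally have *: "(norm a * ?s - norm b * ?t) * (norm a - norm b) \<le> (p_flux p a - p_flux p b) \<bullet> (a - b)" .
  have mono: "x * x powr (p - 2) \<le> y * y powr (p - 2)" if "0 \<le> x" "x \<le> y" for x y :: real
    using that p by (intro mult_mono powr_mono2) auto
  have "0 \<le> (norm a * ?s - norm b * ?t) * (norm a - norm b)"
    using mono[of "norm a" "norm b"] mono[of "norm b" "norm a"]
    by (cases "norm a \<le> norm b") (auto intro: mult_nonpos_nonpos mult_nonneg_nonneg)
  then show ?thesis using * by linarith
qed

text \<open>Test functions are global objects, whereas barriers are only differentiable on an annulus; this lemma
  passes from one to the other.\<close>

lemma C01_test_extend_by_zero: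
  fixes f :: "'a::euclidean_space \<Rightarrow> real"
  assumes E: "open E" and K: "compact K" "K \<subseteq> E"
    and f: "\<And>x. x \<in> E \<Longrightarrow> GDERIV f x :> D x" and D: "continuous_on E D"
    and 0: "\<And>x. x \<in> E - K \<Longrightarrow> f x = 0" "\<And>x. x \<in> E - K \<Longrightarrow> D x = 0"
  shows "C01_test E (\<lambda>x. if x \<in> E then f x else 0) (\<lambda>x. if x \<in> E then D x else 0)"
  unfolding C01_test_def
proof (intro conjI allI)
  let ?f = "\<lambda>x. if x \<in> E then f x else 0" and ?D = "\<lambda>x. if x \<in> E then D x else 0"
  have oK: "open (- K)" using K by (simp add: compact_imp_closed open_Compl)
  have f0: "?f x = 0" and D0: "?D x = 0" if "x \<in> - K" for x
    using that 0[of x] by auto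
  show "GDERIV ?f x :> ?D x" for x
  proof (cases "x \<in> E")
    case True
    have "(f has_derivative (\<lambda>h. h \<bullet> ?D x)) (at x)"
      using f[OF True] True by (simp add: gderiv_def)
    then show ?thesis
      unfolding gderiv_def
      by (rule has_derivative_transform_within_open[OF _ E True]) simp
  next
    case False
    then have x: "x \<in> - K" using K by auto
    have "((\<lambda>x. 0) has_derivative (\<lambda>h. h \<bullet> ?D x)) (at x)"
      using D0[OF x] by simp
    then show ?thesis
      unfolding gderiv_def
      by (rule has_derivative_transform_within_open[OF _ oK x]) (use f0 in auto)
  qed
  have "continuous_on E ?D"
    using D by (rule continuous_on_eq) auto
  moreover have "continuous_on (- K) ?D"
    by (rule continuous_on_eq[OF continuous_on_const[of _ 0]]) (use D0 in auto)
  ultimately have "continuous_on (E \<union> - K) ?D"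
    using E oK by (intro continuous_on_open_Un)
  moreover have "E \<union> - K = UNIV" using K by auto
  ultimately show "continuous_on UNIV ?D" by simp
  have supp: "closure {x. ?f x \<noteq> 0} \<subseteq> K"
  proof (rule closure_minimal)
    show "{x. ?f x \<noteq> 0} \<subseteq> K" using f0 by blast
  qed (use K in \<open>simp add: compact_imp_closed\<close>)
  then show "closure {x. ?f x \<noteq> 0} \<subseteq> E" using K by auto
  show "compact (closure {x. ?f x \<noteq> 0})"
    using compact_Int_closed[OF K(1) closed_closure[of "{x. ?f x \<noteq> 0}"]] supp by (simp add: Int_absorb1)
qed

text \<open>The classical argument tests both equations with the positive part of \<open>\<Phi> - u - e\<close> and
  uses that the flux is monotone. That function is only weakly differentiable, so \<open>u\<close> is
  replaced in it by a \<open>C\<^sup>1\<close> approximation \<open>U\<close> and the positive part by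
  its square. The gradient of \<open>U\<close> is close to \<open>G\<close> in \<open>L\<^sup>p\<close>
  while the fluxes are bounded in the dual space, so the error is arbitrarily small. The strictness
  margin \<open>\<theta>\<close> makes the inequality fail by a fixed amount as soon as
  \<open>\<Phi>\<close> exceeds \<open>u\<close> somewhere; where the test function is positive,
  \<open>u < \<Phi>\<close>, and the absorption term is monotone in \<open>u\<close>.\<close>

lemma weak_comparison_principle:
  fixes \<Omega> E K :: "'a::euclidean_space set" and \<Phi> u h lam0 :: "'a \<Rightarrow> real"
  assumes \<Omega>: "open \<Omega>" and lam0m: "lam0 \<in> borel_measurable (lebesgue_on \<Omega>)"
    and lam0: "\<And>x. x \<in> \<Omega> \<Longrightarrow> 0 \<le> lam0 x" "\<And>x. x \<in> \<Omega> \<Longrightarrow> lam0 x \<le> \<Lambda>"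
    and pq: "2 \<le> p" "0 \<le> q" and sol: "weak_solution p q lam0 \<Omega> g u"
    and E: "open E" "compact (closure E)" "closure E \<subseteq> \<Omega>" and K: "compact K" "K \<subseteq> E"
    and \<Phi>: "\<And>x. x \<in> E \<Longrightarrow> GDERIV \<Phi> x :> D\<Phi> x" and D\<Phi>: "continuous_on E D\<Phi>"
    and bdry: "\<And>x. x \<in> E - K \<Longrightarrow> \<Phi> x \<le> u x"
    and h: "continuous_on E h" and \<theta>: "0 < \<theta>" and hge: "\<And>x. x \<in> E \<Longrightarrow> lam0 x * max (\<Phi> x) 0 powr q + \<theta> \<le> h x"
    and sub: "\<And>\<psi> D. C01_test E \<psi> D \<Longrightarrow> (\<And>x. 0 \<le> \<psi> x) \<Longrightarrow>
        (\<integral>x. p_flux p (D\<Phi> x) \<bullet> D x \<partial>lebesgue_on E) \<le> - (\<integral>x. h x * \<psi> x \<partial>lebesgue_on E)"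
    and z: "z \<in> E"
  shows "\<Phi> z \<le> u z"
proof (rule ccontr)
  assume neg: "\<not> \<Phi> z \<le> u z"
  (* At z the excess is 4 * e; it stays above 3 * e on a ball, and loses e in the approximation of u
     by U and e in the truncation, so that the test function is at least e^2 on that ball. *)
  define e where "e = (\<Phi> z - u z) / 4"
  have e: "0 < e" using neg by (simp add: e_def)
  have E\<Omega>: "E \<subseteq> \<Omega>" using E(3) closure_subset[of E] by blast
  have K\<Omega>: "K \<subseteq> \<Omega>" using E\<Omega> K by blast
  have meas: "K \<in> sets lebesgue" "E \<in> sets lebesgue" "\<Omega> \<in> sets lebesgue"
    using K E \<Omega> by (auto intro: compact_in_sets_lebesgue borel_open)
  interpret K: finite_measure "lebesgue_on K"
    by (rule finite_measure_lebesgue_on_compact[OF K(1)])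
  obtain G where W: "W1p_loc p \<Omega> u G"
    and eq: "\<And>\<phi> D. C01_test \<Omega> \<phi> D \<Longrightarrow> (\<And>x. 0 \<le> \<phi> x) \<Longrightarrow>
           (\<integral>x. norm (G x) powr (p - 2) * (G x \<bullet> D x) \<partial>lebesgue_on \<Omega>) =
             - (\<integral>x. lam0 x * max (u x) 0 powr q * \<phi> x \<partial>lebesgue_on \<Omega>)"
    using sol unfolding weak_solution_def by blast
  have uc: "continuous_on \<Omega> u"
    using sol closure_subset[of \<Omega>] unfolding weak_solution_def by (blast intro: continuous_on_subset)
  have \<Phi>c: "continuous_on E \<Phi>"
    using \<Phi> unfolding gderiv_def by (meson continuous_at_imp_continuous_on has_derivative_continuous)
  have dc: "continuous_on E (\<lambda>x. \<Phi> x - u x)"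
    by (intro continuous_on_diff \<Phi>c continuous_on_subset[OF uc E\<Omega>])
  have "open ((\<lambda>x. \<Phi> x - u x) -` {3 * e<..} \<inter> E)"
    using dc continuous_on_open_vimage[OF E(1), of "\<lambda>x. \<Phi> x - u x"] open_greaterThan by blast
  moreover have "(\<lambda>x. \<Phi> x - u x) -` {3 * e<..} \<inter> E = {x \<in> E. 3 * e < \<Phi> x - u x}" by auto
  ultimately have "open {x \<in> E. 3 * e < \<Phi> x - u x}" by simp
  moreover have "z \<in> {x \<in> E. 3 * e < \<Phi> x - u x}" using z e by (simp add: e_def)
  ultimately obtain \<rho> where \<rho>: "0 < \<rho>" "ball z \<rho> \<subseteq> {x \<in> E. 3 * e < \<Phi> x - u x}"
    unfolding open_contains_ball by blast
  have ballK: "ball z \<rho> \<subseteq> K"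
  proof
    fix x assume "x \<in> ball z \<rho>"
    then have "x \<in> E" "3 * e < \<Phi> x - u x" using \<rho> by auto
    then show "x \<in> K" using bdry[of x] e by (cases "x \<in> K") auto
  qed
  define m where "m = measure lebesgue (ball z \<rho>)"
  have m: "0 < m" unfolding m_def using \<rho>(1) by (simp add: content_ball_pos)
  obtain M where M: "0 < M" and M': "\<And>x. x \<in> K \<Longrightarrow> norm (\<Phi> x - u x) \<le> M"
    using continuous_on_compact_norm_bound[OF K(1) continuous_on_subset[OF dc K(2)]] by blast
  have M2: "\<Phi> x - u x \<le> M" if "x \<in> K" for x using M'[OF that] by simp
  obtain B0 where B0: "0 < B0" "\<And>x. x \<in> K \<Longrightarrow> norm (D\<Phi> x) \<le> B0"
    using continuous_on_compact_norm_bound[OF K(1) continuous_on_subset[OF D\<Phi> K(2)]] by blast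
  define B where "B = B0 powr (p - 1)"
  have B: "0 < B" "norm (p_flux p (D\<Phi> x)) \<le> B" if "x \<in> K" for x
    using B0(1) B0(2)[OF that] pq by (auto simp: B_def norm_p_flux intro!: powr_mono2)
  have B1: "0 < B" using B0 by (simp add: B_def)
  have Gm: "G \<in> borel_measurable (lebesgue_on K)" and Gp: "integrable (lebesgue_on K) (\<lambda>x. norm (G x) powr p)"
    using W K(1) K\<Omega> unfolding W1p_loc_def Lp_loc_def by (auto intro: measurable_restrict_mono)
  define H where "H x = B + norm (G x) powr (p - 1)" for x
  have H0: "0 \<le> H x" for x using B1 by (simp add: H_def)
  have Hm: "H \<in> borel_measurable (lebesgue_on K)"
    unfolding H_def using Gm by measurable
  have Hi: "integrable (lebesgue_on K) (\<lambda>x. H x powr (p / (p - 1)))"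
  proof (rule Bochner_Integration.integrable_bound)
    let ?p' = "p / (p - 1)"
    show "integrable (lebesgue_on K) (\<lambda>x. 2 powr ?p' * (B powr ?p' + norm (G x) powr p))"
      using Gp by auto
    have "H x powr ?p' \<le> 2 powr ?p' * (B powr ?p' + norm (G x) powr p)" for x
      using powr_norm_add_le[of ?p' B "norm (G x) powr (p - 1)"] pq B1 by (simp add: H_def powr_powr)
    then show "AE x in lebesgue_on K. norm (H x powr ?p') \<le> norm (2 powr ?p' * (B powr ?p' + norm (G x) powr p))"
      by simp
  qed (use Hm in measurable)
  (* Wb bounds the weight w of the test gradient whatever U is, hence c may be fixed before U is chosen. *)
  define Wb where "Wb = 2 * M"
  define c where "c = \<theta> * e\<^sup>2 * m / (2 * Wb)"
  have c: "0 < c" using \<theta> e m M by (simp add: c_def Wb_def)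
  obtain d where d: "0 < d" "\<And>a. (\<And>x. 0 \<le> a x) \<Longrightarrow> a \<in> borel_measurable (lebesgue_on K) \<Longrightarrow> integrable (lebesgue_on K) (\<lambda>x. a x powr p) \<Longrightarrow>
      (\<integral>x. a x powr p \<partial>lebesgue_on K) \<le> d \<Longrightarrow> integrable (lebesgue_on K) (\<lambda>x. H x * a x) \<and> (\<integral>x. H x * a x \<partial>lebesgue_on K) \<le> c"
    using Lp_pairing_small[OF _ H0 Hm Hi c] pq by auto
  have de: "0 < min d e" using d e by simp
  have p1: "1 < p" using pq by simp
  obtain U D where UD: "\<And>x. GDERIV U x :> D x" and Dc: "continuous_on UNIV D"
    and Uu: "\<And>x. x \<in> closure E \<Longrightarrow> \<bar>U x - u x\<bar> \<le> min d e"
    and Di: "integrable (lebesgue_on (closure E)) (\<lambda>x. norm (G x - D x) powr p)"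
    and Dd: "(\<integral>x. norm (G x - D x) powr p \<partial>lebesgue_on (closure E)) \<le> min d e"
    using Sobolev_local_C1_approx[OF \<Omega> E(2,3) uc W p1 de] by blast
  have KE: "K \<subseteq> closure E" using K(2) closure_subset[of E] by blast
  have DiK: "integrable (lebesgue_on K) (\<lambda>x. norm (G x - D x) powr p)"
    by (rule lebesgue_on_mono_integrable[OF Di KE meas(1)]) (use E in \<open>auto intro: compact_in_sets_lebesgue\<close>)
  have DdK: "(\<integral>x. norm (G x - D x) powr p \<partial>lebesgue_on K) \<le> d"
  proof -
    have "(\<integral>x. norm (G x - D x) powr p \<partial>lebesgue_on K) = (\<integral>x. (if x \<in> K then norm (G x - D x) powr p else 0) \<partial>lebesgue)"
      by (rule Lebesgue_Measure.integral_restrict_UNIV[symmetric, OF meas(1)])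
    also have "\<dots> \<le> (\<integral>x. (if x \<in> closure E then norm (G x - D x) powr p else 0) \<partial>lebesgue)"
      using DiK Di KE meas(1) compact_in_sets_lebesgue[OF E(2)]
      by (intro integral_mono) (auto simp: Lebesgue_Measure.integrable_restrict_UNIV)
    also have "\<dots> = (\<integral>x. norm (G x - D x) powr p \<partial>lebesgue_on (closure E))"
      by (rule Lebesgue_Measure.integral_restrict_UNIV[OF compact_in_sets_lebesgue[OF E(2)]])
    finally show ?thesis using Dd by simp
  qed
  have Dm: "D \<in> borel_measurable (lebesgue_on K)"
    by (rule continuous_imp_measurable_on_sets_lebesgue[OF continuous_on_subset[OF Dc] meas(1)]) simp
  have am: "(\<lambda>x. norm (G x - D x)) \<in> borel_measurable (lebesgue_on K)"
    using Gm Dm by measurable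
  have pair: "integrable (lebesgue_on K) (\<lambda>x. H x * norm (G x - D x))"
    "(\<integral>x. H x * norm (G x - D x) \<partial>lebesgue_on K) \<le> c"
    using d(2)[OF norm_ge_zero am DiK DdK] by auto
  (* The gradient of the test function is a nonnegative weight times D\<Phi> - D, the factor against which the
     difference of the fluxes is monotone once D is exchanged for G. *)
  define w where "w x = 2 * max 0 (\<Phi> x - U x - e)" for x
  define f where "f x = (max 0 (\<Phi> x - U x - e))\<^sup>2" for x
  define Df where "Df x = w x *\<^sub>R (D\<Phi> x - D x)" for x
  have Ud: "\<bar>U x - u x\<bar> \<le> e" if "x \<in> E" for x
    using Uu[of x] that closure_subset[of E] by auto
  have w0: "0 \<le> w x" for x by (simp add: w_def)
  have wz: "\<Phi> x - U x - e \<le> 0" if "x \<in> E - K" for x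
    using bdry[OF that] Ud[of x] that by auto
  have wW: "w x \<le> Wb" if "x \<in> K" for x
    using M2[OF that] M Ud[of x] that K(2) by (auto simp: w_def Wb_def)
  have Uc: "continuous_on UNIV U"
    using UD unfolding gderiv_def by (meson continuous_at_imp_continuous_on has_derivative_continuous)
  have wc: "continuous_on E w"
    unfolding w_def by (intro continuous_intros \<Phi>c continuous_on_subset[OF Uc]) auto
  have Dfc: "continuous_on E Df"
    unfolding Df_def by (intro continuous_intros wc D\<Phi> continuous_on_subset[OF Dc]) auto
  define \<phi> where "\<phi> x = (if x \<in> E then f x else 0)" for x
  define D\<phi> where "D\<phi> x = (if x \<in> E then Df x else 0)" for x
  have test: "C01_test E \<phi> D\<phi>"
    unfolding \<phi>_def[abs_def] D\<phi>_def[abs_def]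
  proof (rule C01_test_extend_by_zero[OF E(1) K])
    show "GDERIV f x :> Df x" if "x \<in> E" for x
    proof -
      have g: "GDERIV (\<lambda>x. \<Phi> x - U x - e) x :> D\<Phi> x - D x - 0"
        by (intro GDERIV_diff \<Phi>[OF that] UD GDERIV_const)
      show ?thesis
        using GDERIV_DERIV_compose[OF g DERIV_pos_part_square]
        by (simp add: f_def[abs_def] Df_def w_def)
    qed
    show "f x = 0" if "x \<in> E - K" for x using wz[OF that] by (simp add: f_def max_def)
    show "Df x = 0" if "x \<in> E - K" for x using wz[OF that] by (simp add: Df_def w_def max_def)
  qed (rule Dfc)
  have test\<Omega>: "C01_test \<Omega> \<phi> D\<phi>"
    using test E\<Omega> unfolding C01_test_def by blast
  have \<phi>0: "0 \<le> \<phi> x" for x by (simp add: \<phi>_def f_def)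
  have D\<phi>c: "continuous_on K D\<phi>"
    using test unfolding C01_test_def by (blast intro: continuous_on_subset)
  have \<phi>c: "continuous_on K \<phi>"
    using test unfolding C01_test_def gderiv_def by (meson continuous_at_imp_continuous_on has_derivative_continuous)
  have off: "\<phi> x = 0" "D\<phi> x = 0" if "x \<notin> K" for x
    using that wz[of x] by (auto simp: \<phi>_def D\<phi>_def f_def Df_def w_def max_def)
  have onK: "\<phi> x = f x" "D\<phi> x = Df x" if "x \<in> K" for x
    using that K(2) by (auto simp: \<phi>_def D\<phi>_def)
  have I1: "(\<integral>x. p_flux p (D\<Phi> x) \<bullet> D\<phi> x \<partial>lebesgue_on K) \<le> - (\<integral>x. h x * \<phi> x \<partial>lebesgue_on K)"
    using sub[OF test \<phi>0] integral_lebesgue_on_extend[OF meas(1,2) K(2), of "\<lambda>x. p_flux p (D\<Phi> x) \<bullet> D\<phi> x"]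
      integral_lebesgue_on_extend[OF meas(1,2) K(2), of "\<lambda>x. h x * \<phi> x"] off by simp
  have I2: "(\<integral>x. p_flux p (G x) \<bullet> D\<phi> x \<partial>lebesgue_on K) = - (\<integral>x. lam0 x * max (u x) 0 powr q * \<phi> x \<partial>lebesgue_on K)"
    using eq[OF test\<Omega> \<phi>0] integral_lebesgue_on_extend[OF meas(1,3) K\<Omega>, of "\<lambda>x. p_flux p (G x) \<bullet> D\<phi> x"]
      integral_lebesgue_on_extend[OF meas(1,3) K\<Omega>, of "\<lambda>x. lam0 x * max (u x) 0 powr q * \<phi> x"] off
    by (simp add: p_flux_def)
  have lam0K: "lam0 \<in> borel_measurable (lebesgue_on K)"
    by (rule measurable_restrict_mono[OF lam0m K\<Omega>])
  have um: "u \<in> borel_measurable (lebesgue_on K)"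
    by (rule continuous_imp_measurable_on_sets_lebesgue[OF continuous_on_subset[OF uc K\<Omega>] meas(1)])
  obtain B2 where B2: "0 < B2" "\<And>x. x \<in> K \<Longrightarrow> norm (D\<phi> x) \<le> B2"
    using continuous_on_compact_norm_bound[OF K(1) D\<phi>c] by blast
  obtain B3 where B3: "0 < B3" "\<And>x. x \<in> K \<Longrightarrow> norm (max (u x) 0 powr q * \<phi> x) \<le> B3"
  proof -
    obtain A1 where A1: "\<And>x. x \<in> K \<Longrightarrow> norm (u x) \<le> A1"
      using continuous_on_compact_norm_bound[OF K(1) continuous_on_subset[OF uc K\<Omega>]] by blast
    obtain A2 where A2: "0 < A2" "\<And>x. x \<in> K \<Longrightarrow> norm (\<phi> x) \<le> A2"
      using continuous_on_compact_norm_bound[OF K(1) \<phi>c] by blast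
    show ?thesis
    proof (rule that[of "(\<bar>A1\<bar> + 1) powr q * A2"])
      fix x assume x: "x \<in> K"
      have "max (u x) 0 powr q \<le> (\<bar>A1\<bar> + 1) powr q"
        using A1[OF x] pq by (intro powr_mono2) auto
      then show "norm (max (u x) 0 powr q * \<phi> x) \<le> (\<bar>A1\<bar> + 1) powr q * A2"
        using A2(2)[OF x] by (auto simp: abs_mult intro!: mult_mono)
    qed (use A2 in auto)
  qed
  have D\<Phi>m: "D\<Phi> \<in> borel_measurable (lebesgue_on K)"
    by (rule continuous_imp_measurable_on_sets_lebesgue[OF continuous_on_subset[OF D\<Phi> K(2)] meas(1)])
  have D\<phi>m: "D\<phi> \<in> borel_measurable (lebesgue_on K)" and \<phi>m: "\<phi> \<in> borel_measurable (lebesgue_on K)"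
    using continuous_imp_measurable_on_sets_lebesgue[OF D\<phi>c meas(1)] continuous_imp_measurable_on_sets_lebesgue[OF \<phi>c meas(1)] by auto
  have int1: "integrable (lebesgue_on K) (\<lambda>x. p_flux p (D\<Phi> x) \<bullet> D\<phi> x)"
  proof (rule K.integrable_const_bound[where B="B * B2"])
    show "AE x in lebesgue_on K. norm (p_flux p (D\<Phi> x) \<bullet> D\<phi> x) \<le> B * B2"
    proof (rule AE_I2)
      fix x assume "x \<in> space (lebesgue_on K)"
      then have x: "x \<in> K" by simp
      show "norm (p_flux p (D\<Phi> x) \<bullet> D\<phi> x) \<le> B * B2"
        using order_trans[OF Cauchy_Schwarz_ineq2 mult_mono[OF B(2)[OF x] B2(2)[OF x]]] B1 by simp
    qed
    show "(\<lambda>x. p_flux p (D\<Phi> x) \<bullet> D\<phi> x) \<in> borel_measurable (lebesgue_on K)"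
      using D\<Phi>m D\<phi>m by measurable
  qed
  have int2: "integrable (lebesgue_on K) (\<lambda>x. h x * \<phi> x)"
    by (intro integrable_lebesgue_on_compact_continuous[OF K(1)] continuous_intros \<phi>c continuous_on_subset[OF h K(2)])
  have int3: "integrable (lebesgue_on K) (\<lambda>x. p_flux p (G x) \<bullet> D\<phi> x)"
  proof (rule Bochner_Integration.integrable_bound)
    show "integrable (lebesgue_on K) (\<lambda>x. (1 + norm (G x) powr p) * B2)"
      using Gp by auto
    show "AE x in lebesgue_on K. norm (p_flux p (G x) \<bullet> D\<phi> x) \<le> norm ((1 + norm (G x) powr p) * B2)"
    proof (rule AE_I2)
      fix x assume "x \<in> space (lebesgue_on K)"
      then have x: "x \<in> K" by simp
      have "norm (p_flux p (G x)) \<le> 1 + norm (G x) powr p"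
        using powr_le_one_plus_powr[of "norm (G x)" "p - 1" p] pq by (simp add: norm_p_flux)
      from order_trans[OF Cauchy_Schwarz_ineq2 mult_mono[OF this B2(2)[OF x]]]
      show "norm (p_flux p (G x) \<bullet> D\<phi> x) \<le> norm ((1 + norm (G x) powr p) * B2)"
        using B2(1) by (simp add: add_nonneg_nonneg)
    qed
    show "(\<lambda>x. p_flux p (G x) \<bullet> D\<phi> x) \<in> borel_measurable (lebesgue_on K)"
      using Gm D\<phi>m by measurable
  qed
  have int4: "integrable (lebesgue_on K) (\<lambda>x. lam0 x * max (u x) 0 powr q * \<phi> x)"
  proof (rule K.integrable_const_bound[where B="\<Lambda> * B3"])
    show "AE x in lebesgue_on K. norm (lam0 x * max (u x) 0 powr q * \<phi> x) \<le> \<Lambda> * B3"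
    proof (rule AE_I2)
      fix x assume "x \<in> space (lebesgue_on K)"
      then have x: "x \<in> K" "x \<in> \<Omega>" using K\<Omega> by auto
      have "norm (lam0 x) \<le> \<Lambda>" using lam0[OF x(2)] by simp
      from mult_mono[OF this B3(2)[OF x(1)]]
      show "norm (lam0 x * max (u x) 0 powr q * \<phi> x) \<le> \<Lambda> * B3"
        using lam0[OF x(2)] by (simp add: abs_mult mult.assoc)
    qed
    show "(\<lambda>x. lam0 x * max (u x) 0 powr q * \<phi> x) \<in> borel_measurable (lebesgue_on K)"
      using lam0K um \<phi>m by measurable
  qed
  have int5: "integrable (lebesgue_on K) (\<lambda>x. \<theta> * \<phi> x)"
    by (intro integrable_lebesgue_on_compact_continuous[OF K(1)] continuous_intros \<phi>c)
  (* Subtracting the equation for u from the inequality for \<Phi> makes the integral of ?T nonpositive, whereas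
     ?T is at least \<theta> * \<phi> up to the error of approximating G by D. *)
  let ?T = "\<lambda>x. (p_flux p (D\<Phi> x) \<bullet> D\<phi> x - p_flux p (G x) \<bullet> D\<phi> x) + (h x * \<phi> x - lam0 x * max (u x) 0 powr q * \<phi> x)"
  have "(\<integral>x. ?T x \<partial>lebesgue_on K) \<le> 0"
    using int1 int2 int3 int4 I1 I2 by simp
  moreover have "(\<integral>x. \<theta> * \<phi> x - Wb * (H x * norm (G x - D x)) \<partial>lebesgue_on K) \<le> (\<integral>x. ?T x \<partial>lebesgue_on K)"
  proof (rule integral_mono)
    show "integrable (lebesgue_on K) (\<lambda>x. \<theta> * \<phi> x - Wb * (H x * norm (G x - D x)))"
      using int5 pair(1) by auto
    show "integrable (lebesgue_on K) ?T" using int1 int2 int3 int4 by auto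
    fix x assume "x \<in> space (lebesgue_on K)"
    then have x: "x \<in> K" by simp
    then have xE: "x \<in> E" "x \<in> \<Omega>" using K(2) K\<Omega> by auto
    have a: "\<theta> * \<phi> x \<le> h x * \<phi> x - lam0 x * max (u x) 0 powr q * \<phi> x"
    proof (cases "\<Phi> x - U x - e > 0")
      case True
      then have "u x \<le> \<Phi> x" using Ud[OF xE(1)] by auto
      then have "max (u x) 0 powr q \<le> max (\<Phi> x) 0 powr q"
        using pq by (intro powr_mono2) auto
      then have "lam0 x * max (u x) 0 powr q \<le> lam0 x * max (\<Phi> x) 0 powr q"
        using lam0(1)[OF xE(2)] by (rule mult_left_mono)
      then have "\<theta> \<le> h x - lam0 x * max (u x) 0 powr q" using hge[OF xE(1)] by simp
      from mult_right_mono[OF this \<phi>0[of x]] show ?thesis by (simp add: algebra_simps)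
    next
      case False
      then have "\<phi> x = 0" by (simp add: \<phi>_def f_def max_def)
      then show ?thesis by simp
    qed
    (* Monotonicity needs the true gradient G in the second factor; exchanging D for G costs H * |G - D|. *)
    have "(p_flux p (D\<Phi> x) - p_flux p (G x)) \<bullet> (D\<Phi> x - D x)
        = (p_flux p (D\<Phi> x) - p_flux p (G x)) \<bullet> (D\<Phi> x - G x) + (p_flux p (D\<Phi> x) - p_flux p (G x)) \<bullet> (G x - D x)"
      by (simp add: inner_diff_right)
    moreover have "\<bar>(p_flux p (D\<Phi> x) - p_flux p (G x)) \<bullet> (G x - D x)\<bar> \<le> H x * norm (G x - D x)"
    proof (rule order_trans[OF Cauchy_Schwarz_ineq2 mult_right_mono])
      show "norm (p_flux p (D\<Phi> x) - p_flux p (G x)) \<le> H x"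
        using norm_triangle_ineq4[of "p_flux p (D\<Phi> x)" "p_flux p (G x)"] B(2)[OF x] norm_p_flux[OF pq(1), of "G x"]
        by (simp add: H_def)
    qed simp
    ultimately have "- (H x * norm (G x - D x)) \<le> (p_flux p (D\<Phi> x) - p_flux p (G x)) \<bullet> (D\<Phi> x - D x)"
      using p_flux_monotone[OF pq(1), of "D\<Phi> x" "G x"] by linarith
    from mult_left_mono[OF this w0[of x]]
    have "- (w x * (H x * norm (G x - D x))) \<le> p_flux p (D\<Phi> x) \<bullet> D\<phi> x - p_flux p (G x) \<bullet> D\<phi> x"
      by (simp add: onK[OF x] Df_def inner_diff_left right_diff_distrib)
    moreover have "w x * (H x * norm (G x - D x)) \<le> Wb * (H x * norm (G x - D x))"
      using wW[OF x] H0 by (intro mult_right_mono) auto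
    ultimately show "\<theta> * \<phi> x - Wb * (H x * norm (G x - D x)) \<le> ?T x"
      using a by linarith
  qed
  moreover have "(\<integral>x. \<theta> * \<phi> x - Wb * (H x * norm (G x - D x)) \<partial>lebesgue_on K)
      = (\<integral>x. \<theta> * \<phi> x \<partial>lebesgue_on K) - Wb * (\<integral>x. H x * norm (G x - D x) \<partial>lebesgue_on K)"
    using int5 pair(1) by simp
  moreover have "Wb * (\<integral>x. H x * norm (G x - D x) \<partial>lebesgue_on K) \<le> Wb * c"
    using pair(2) M by (intro mult_left_mono) (auto simp: Wb_def)
  moreover have "Wb * c = \<theta> * e\<^sup>2 * m / 2" using M by (simp add: c_def Wb_def)
  moreover have "\<theta> * e\<^sup>2 * m \<le> (\<integral>x. \<theta> * \<phi> x \<partial>lebesgue_on K)"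
  proof -
    have \<phi>ball: "e\<^sup>2 \<le> \<phi> x" if "x \<in> ball z \<rho>" for x
    proof -
      have x: "x \<in> E" "3 * e < \<Phi> x - u x" using that \<rho> by auto
      then have "e \<le> max 0 (\<Phi> x - U x - e)" using Ud[OF x(1)] by auto
      then show ?thesis using e x by (simp add: \<phi>_def f_def power_mono)
    qed
    have "\<theta> * e\<^sup>2 * m = (\<integral>x. \<theta> * e\<^sup>2 * indicator (ball z \<rho>) x \<partial>lebesgue)"
      by (simp add: m_def)
    also have "\<dots> \<le> (\<integral>x. (if x \<in> K then \<theta> * \<phi> x else 0) \<partial>lebesgue)"
    proof (rule integral_mono)
      show "integrable lebesgue (\<lambda>x. \<theta> * e\<^sup>2 * indicator (ball z \<rho>) x)"
        by (intro integrable_mult_right) (simp add: lmeasurable_ball flip: lmeasurable_iff_integrable)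
      show "integrable lebesgue (\<lambda>x. if x \<in> K then \<theta> * \<phi> x else 0)"
        using int5 meas by (simp add: Lebesgue_Measure.integrable_restrict_UNIV)
      show "\<theta> * e\<^sup>2 * indicator (ball z \<rho>) x \<le> (if x \<in> K then \<theta> * \<phi> x else 0)" for x
        using \<phi>ball[of x] ballK \<phi>0[of x] \<theta> by (auto simp: indicator_def)
    qed
    also have "\<dots> = (\<integral>x. \<theta> * \<phi> x \<partial>lebesgue_on K)"
      by (rule Lebesgue_Measure.integral_restrict_UNIV[OF meas(1)])
    finally show ?thesis .
  qed
  moreover have "0 < \<theta> * e\<^sup>2 * m" using \<theta> e m by simp
  ultimately show False by linarith
qed

section \<open>Radial functions\<close>

lemma lborel_integral_affine:
  fixes f :: "'a::euclidean_space \<Rightarrow> real"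
  assumes f: "f \<in> borel_measurable borel" and c: "c \<noteq> 0"
  shows "(\<integral>x. f (t + c *\<^sub>R x) \<partial>lborel) = (\<integral>x. f x \<partial>lborel) / \<bar>c\<bar> ^ DIM('a)"
proof -
  note [measurable] = f
  have "(\<integral>x. f x \<partial>lborel) = (\<integral>x. f x \<partial>density (distr lborel borel (\<lambda>x. t + c *\<^sub>R x)) (\<lambda>_. ennreal (\<bar>c\<bar> ^ DIM('a))))"
    using lborel_affine[OF c, of t] by (simp add: ennreal_power)
  also have "\<dots> = (\<integral>x. \<bar>c\<bar> ^ DIM('a) * f x \<partial>distr lborel borel (\<lambda>x. t + c *\<^sub>R x))"
    by (subst integral_density) auto
  also have "\<dots> = \<bar>c\<bar> ^ DIM('a) * (\<integral>x. f (t + c *\<^sub>R x) \<partial>lborel)"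
    by (subst integral_distr) auto
  finally show ?thesis using c by simp
qed

lemma DERIV_LIMSEQ_quotient:
  fixes g :: "real \<Rightarrow> real"
  assumes "(g has_real_derivative d) (at a)"
  shows "(\<lambda>n. (g (a + inverse (Suc n)) - g a) * Suc n) \<longlonglongrightarrow> d"
proof -
  have "(\<lambda>h. (g (a + h) - g a) / h) \<midarrow>0\<rightarrow> d"
    using assms by (simp add: DERIV_def)
  moreover have "filterlim (\<lambda>n. inverse (real (Suc n))) (at 0) sequentially"
    using LIMSEQ_inverse_real_of_nat by (auto simp: filterlim_at)
  ultimately have "(\<lambda>n. (g (a + inverse (real (Suc n))) - g a) / inverse (real (Suc n))) \<longlonglongrightarrow> d"
    by (rule filterlim_compose)
  then show ?thesis by (simp add: field_simps)
qed

text \<open>The divergence theorem for \<open>f(x) *\<^sub>R (x - y)\<close>. The integral of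
  \<open>f(y + c *\<^sub>R (x - y))\<close> over \<open>x\<close> scales like \<open>c\<close> to the
  power minus the dimension; differentiate at \<open>c = 1\<close> under the integral sign.\<close>

lemma integral_dilation_derivative:
  fixes f :: "'a::euclidean_space \<Rightarrow> real"
  assumes f: "\<And>x. GDERIV f x :> D x" and D: "continuous_on UNIV D"
    and R: "\<And>x. R \<le> norm (x - y) \<Longrightarrow> f x = 0" "\<And>x. R \<le> norm (x - y) \<Longrightarrow> D x = 0"
  shows "(\<integral>x. (x - y) \<bullet> D x \<partial>lebesgue) = - real DIM('a) * (\<integral>x. f x \<partial>lebesgue)"
proof -
  have fc: "continuous_on UNIV f"
    using f unfolding gderiv_def by (meson continuous_at_imp_continuous_on has_derivative_continuous)
  have fm[measurable]: "f \<in> borel_measurable borel" and Dm[measurable]: "D \<in> borel_measurable borel"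
    using fc D by (auto intro: borel_measurable_continuous_onI)
  have nle: "R + norm y \<le> norm x \<Longrightarrow> R \<le> norm (x - y)" for x
    using norm_triangle_ineq2[of x y] by linarith
  obtain B where B: "0 < B" "\<And>x. norm (D x) \<le> B"
    using continuous_compact_support_bounded[OF D, of "R + norm y"] R(2) nle by blast
  obtain Bf where Bf: "0 < Bf" "\<And>x. norm (f x) \<le> Bf"
    using continuous_compact_support_bounded[OF fc, of "R + norm y"] R(1) nle by blast
  define S where "S = \<bar>R\<bar>"
  have cb: "integrable lborel (\<lambda>x. c * indicator (cball y S) x)" for c :: real
    by (intro integrable_mult_right) (use emeasure_bounded_finite[of "cball y S"] in \<open>auto simp: integrable_indicator_iff\<close>)
  have fint: "integrable lborel f"
  proof (rule Bochner_Integration.integrable_bound[OF cb[of Bf]])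
    show "AE x in lborel. norm (f x) \<le> norm (Bf * indicator (cball y S) x)"
    proof (rule AE_I2)
      fix x show "norm (f x) \<le> norm (Bf * indicator (cball y S) x)"
        using Bf(2)[of x] Bf(1) R(1)[of x] by (cases "x \<in> cball y S") (auto simp: S_def dist_norm norm_minus_commute)
    qed
  qed simp
  (* The factors c n > 1 expand about y, so every dilate vanishes where f does beyond radius R. *)
  define c where "c n = 1 + inverse (real (Suc n))" for n
  have c: "1 < c n" for n by (simp add: c_def)
  define g where "g x s = f (y + s *\<^sub>R (x - y))" for x s
  have g: "(g x has_real_derivative (x - y) \<bullet> D (y + s *\<^sub>R (x - y))) (at s)" for x s
  proof -
    have "((\<lambda>s. y + s *\<^sub>R (x - y)) has_derivative (\<lambda>h. h *\<^sub>R (x - y))) (at s)"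
      by (auto intro!: derivative_eq_intros)
    from has_derivative_compose[OF this f[of "y + s *\<^sub>R (x - y)", unfolded gderiv_def]]
    show ?thesis unfolding has_field_derivative_def g_def[abs_def]
      by (simp add: mult_commute_abs)
  qed
  have lim1: "(\<lambda>n. \<integral>x. (g x (c n) - g x 1) * Suc n \<partial>lborel) \<longlonglongrightarrow> (\<integral>x. (x - y) \<bullet> D x \<partial>lborel)"
  proof (rule integral_dominated_convergence[where w="\<lambda>x. (S * B) * indicator (cball y S) x"])
    show "AE x in lborel. (\<lambda>n. (g x (c n) - g x 1) * Suc n) \<longlonglongrightarrow> (x - y) \<bullet> D x"
      using DERIV_LIMSEQ_quotient[OF g[of _ 1]] by (intro AE_I2) (simp add: c_def)
    show "AE x in lborel. norm ((g x (c n) - g x 1) * Suc n) \<le> (S * B) * indicator (cball y S) x" for n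
    proof (rule AE_I2)
      fix x :: 'a
      show "norm ((g x (c n) - g x 1) * Suc n) \<le> (S * B) * indicator (cball y S) x"
      proof (cases "x \<in> cball y S")
        case True
        obtain s where s: "1 < s" "s < c n" "g x (c n) - g x 1 = (c n - 1) * ((x - y) \<bullet> D (y + s *\<^sub>R (x - y)))"
          using MVT2[OF c[of n] g] by blast
        have "(g x (c n) - g x 1) * Suc n = (x - y) \<bullet> D (y + s *\<^sub>R (x - y))"
          unfolding s(3) by (simp add: c_def)
        also have "norm \<dots> \<le> norm (x - y) * norm (D (y + s *\<^sub>R (x - y)))"
          using Cauchy_Schwarz_ineq2 by simp
        also have "\<dots> \<le> S * B"
          using True B by (intro mult_mono) (auto simp: S_def dist_norm norm_minus_commute)
        finally show ?thesis using True by simp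
      next
        case False
        then have x: "R \<le> norm (x - y)" by (simp add: S_def dist_norm norm_minus_commute)
        have "1 * norm (x - y) \<le> c n * norm (x - y)" using c[of n] by (intro mult_right_mono) auto
        then have "R \<le> norm ((y + c n *\<^sub>R (x - y)) - y)" using x c[of n] by simp
        then have "g x (c n) = 0" "g x 1 = 0" using R(1) x by (auto simp: g_def)
        then show ?thesis using False by simp
      qed
    qed
    show "(\<lambda>x. (g x (c n) - g x 1) * Suc n) \<in> borel_measurable lborel" for n
      unfolding g_def by measurable
  qed (use cb in \<open>auto\<close>)
  have quot: "(\<integral>x. (g x (c n) - g x 1) * Suc n \<partial>lborel) = (1 / (c n) ^ DIM('a) - 1 / 1 ^ DIM('a)) * Suc n * (\<integral>x. f x \<partial>lborel)" for n
  proof -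
    have e: "g x (c n) = f ((y - c n *\<^sub>R y) + c n *\<^sub>R x)" for x
      by (simp add: g_def algebra_simps)
    have cn: "c n \<noteq> 0" using c[of n] by simp
    have i: "(\<integral>x. g x (c n) \<partial>lborel) = (\<integral>x. f x \<partial>lborel) / c n ^ DIM('a)"
      unfolding e using lborel_integral_affine[OF fm cn] c[of n] by simp
    have "integrable lborel (\<lambda>x. g x (c n))"
    proof (rule Bochner_Integration.integrable_bound[OF cb[of Bf]])
      show "AE x in lborel. norm (g x (c n)) \<le> norm (Bf * indicator (cball y S) x)"
      proof (rule AE_I2)
        fix x :: 'a
        have "1 * norm (x - y) \<le> c n * norm (x - y)" using c[of n] by (intro mult_right_mono) auto
        then have "g x (c n) = 0" if "R \<le> norm (x - y)"
          using that c[of n] R(1)[of "y + c n *\<^sub>R (x - y)"] by (simp add: g_def)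
        then show "norm (g x (c n)) \<le> norm (Bf * indicator (cball y S) x)"
          using Bf(1) Bf(2)[of "y + c n *\<^sub>R (x - y)"]
          by (cases "x \<in> cball y S") (auto simp: g_def S_def dist_norm norm_minus_commute)
      qed
    qed (simp add: g_def)
    moreover have "g x 1 = f x" for x by (simp add: g_def)
    ultimately show ?thesis using fint i by (simp add: algebra_simps add_divide_distrib)
  qed
  have lim2: "(\<lambda>n. (1 / (c n) ^ DIM('a) - 1 / 1 ^ DIM('a)) * Suc n * (\<integral>x. f x \<partial>lborel))
      \<longlonglongrightarrow> - real DIM('a) * (\<integral>x. f x \<partial>lborel)"
  proof -
    have "((\<lambda>s::real. 1 / s ^ DIM('a)) has_real_derivative - real DIM('a)) (at 1)"
      by (auto intro!: derivative_eq_intros)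
    from DERIV_LIMSEQ_quotient[OF this] show ?thesis
      unfolding c_def by (intro tendsto_intros)
  qed
  have "(\<integral>x. (x - y) \<bullet> D x \<partial>lborel) = - real DIM('a) * (\<integral>x. f x \<partial>lborel)"
    by (rule LIMSEQ_unique[OF lim1[unfolded quot] lim2])
  then show ?thesis by (subst (1 2) integral_completion) auto
qed

lemma C01_test_zero_off_support:
  assumes t: "C01_test E \<psi> D" and x: "x \<notin> closure {x. \<psi> x \<noteq> 0}"
  shows "\<psi> x = 0" "D x = 0"
proof -
  show "\<psi> x = 0" using x closure_subset[of "{x. \<psi> x \<noteq> 0}"] by auto
  have "((\<lambda>x. 0) has_derivative (\<lambda>h. h \<bullet> D x)) (at x)"
  proof (rule has_derivative_transform_within_open[of \<psi> _ _ _ "- closure {x. \<psi> x \<noteq> 0}"])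
    show "(\<psi> has_derivative (\<lambda>h. h \<bullet> D x)) (at x)"
      using t unfolding C01_test_def gderiv_def by blast
    show "\<psi> z = 0" if "z \<in> - closure {x. \<psi> x \<noteq> 0}" for z
      using that closure_subset[of "{x. \<psi> x \<noteq> 0}"] by auto
  qed (use x in auto)
  from has_derivative_unique[OF this has_derivative_const]
  have "D x \<bullet> D x = 0" by metis
  then show "D x = 0" by simp
qed

lemma GDERIV_radial:
  fixes y :: "'a::euclidean_space"
  assumes "x \<noteq> y" "(F has_real_derivative d) (at (norm (x - y)))"
  shows "GDERIV (\<lambda>x. F (norm (x - y))) x :> (d / norm (x - y)) *\<^sub>R (x - y)"
proof -
  have "((\<lambda>x. x - y) has_derivative (\<lambda>h. h)) (at x)"
    by (auto intro!: derivative_eq_intros)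
  from has_derivative_compose[OF this, of norm "\<lambda>h. h \<bullet> sgn (x - y)"] GDERIV_norm[of "x - y"] assms(1)
  have "GDERIV (\<lambda>x. norm (x - y)) x :> sgn (x - y)"
    unfolding gderiv_def by simp
  from GDERIV_DERIV_compose[OF this assms(2)] show ?thesis
    by (simp add: sgn_div_norm divide_inverse)
qed

text \<open>Integration by parts for the flux of a radial decreasing function with slope \<open>- g\<close>. The
  right-hand side carries its pointwise \<open>p\<close>-Laplacian
  \<open>- (m' + (N - 1) / s * m)\<close> with \<open>m = g powr (p - 1)\<close>.\<close>

lemma radial_weak_p_Laplacian:
  fixes y :: "'a::euclidean_space" and g g1 :: "real \<Rightarrow> real"
  assumes p: "2 \<le> p" and a: "0 < a"
    and g: "\<And>s. a < s \<Longrightarrow> s < b \<Longrightarrow> (g has_real_derivative g1 s) (at s)"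
    and g0: "\<And>s. a < s \<Longrightarrow> s < b \<Longrightarrow> 0 < g s"
    and g1: "continuous_on {a<..<b} g1"
    and test: "C01_test {x. a < norm (x - y) \<and> norm (x - y) < b} \<psi> D"
  shows "(\<integral>x. p_flux p ((- g (norm (x - y)) / norm (x - y)) *\<^sub>R (x - y)) \<bullet> D x
            \<partial>lebesgue_on {x. a < norm (x - y) \<and> norm (x - y) < b})
       = - (\<integral>x. (- ((p - 1) * g (norm (x - y)) powr (p - 2) * g1 (norm (x - y))
              + (real DIM('a) - 1) / norm (x - y) * g (norm (x - y)) powr (p - 1))) * \<psi> x
            \<partial>lebesgue_on {x. a < norm (x - y) \<and> norm (x - y) < b})"
proof -
  define E where "E = {x. a < norm (x - y) \<and> norm (x - y) < b}"
  have E: "open E" unfolding E_def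
    by (intro open_Collect_conj open_Collect_less continuous_intros)
  note test' = test[folded E_def]
  define K where "K = closure {x. \<psi> x \<noteq> 0}"
  have K: "compact K" "K \<subseteq> E" using test' by (auto simp: C01_test_def K_def)
  have meas: "K \<in> sets lebesgue" "E \<in> sets lebesgue"
    using K E by (auto intro: compact_in_sets_lebesgue borel_open)
  have off: "\<psi> x = 0" "D x = 0" if "x \<notin> K" for x
    using C01_test_zero_off_support[OF test'] that unfolding K_def by blast+
  have \<psi>: "\<And>x. GDERIV \<psi> x :> D x" and Dc: "continuous_on UNIV D"
    using test by (auto simp: C01_test_def)
  have \<psi>c: "continuous_on UNIV \<psi>"
    using \<psi> unfolding gderiv_def by (meson continuous_at_imp_continuous_on has_derivative_continuous)
  define m where "m s = g s powr (p - 1)" for s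
  define m1 where "m1 s = (p - 1) * g s powr (p - 2) * g1 s" for s
  have m: "(m has_real_derivative m1 s) (at s)" if "a < s" "s < b" for s
    using DERIV_fun_powr[OF g[OF that] g0[OF that], of "p - 1"] by (simp add: m_def[abs_def] m1_def diff_diff_eq)
  define k where "k s = m s / s" for s
  define k1 where "k1 s = m1 s / s - m s / s\<^sup>2" for s
  have k: "(k has_real_derivative k1 s) (at s)" if "a < s" "s < b" for s
    unfolding k_def[abs_def] k1_def
    by (rule derivative_eq_intros m[OF that] refl)+ (use that a in \<open>auto simp: power2_eq_square field_simps\<close>)
  have gc: "continuous_on {a<..<b} g"
    using g by (meson DERIV_isCont continuous_at_imp_continuous_on greaterThanLessThan_iff)
  have k1c: "continuous_on {a<..<b} k1"
    unfolding k1_def m1_def m_def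
    by (intro continuous_intros gc g1) (use g0 a in \<open>auto simp: less_imp_neq[symmetric]\<close>)
  have ncE: "continuous_on E (\<lambda>x. norm (x - y))" by (intro continuous_intros)
  have nE: "(\<lambda>x. norm (x - y)) ` E \<subseteq> {a<..<b}" by (auto simp: E_def)
  have kc: "continuous_on {a<..<b} k"
    using k by (meson DERIV_isCont continuous_at_imp_continuous_on greaterThanLessThan_iff)
  (* F extends \<psi> * m(s) / s, where s = norm (x - y): the field is then - (m(s) / s) *\<^sub>R (x - y), and the
     dilation formula for F is its divergence theorem against \<psi>. *)
  define f where "f x = \<psi> x * k (norm (x - y))" for x
  define Df where "Df x = \<psi> x *\<^sub>R ((k1 (norm (x - y)) / norm (x - y)) *\<^sub>R (x - y)) + k (norm (x - y)) *\<^sub>R D x" for x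
  define F where "F x = (if x \<in> E then f x else 0)" for x
  define DF where "DF x = (if x \<in> E then Df x else 0)" for x
  have tF: "C01_test E F DF"
    unfolding F_def[abs_def] DF_def[abs_def]
  proof (rule C01_test_extend_by_zero[OF E K])
    show "GDERIV f x :> Df x" if "x \<in> E" for x
      unfolding f_def[abs_def] Df_def
      by (rule GDERIV_mult[OF \<psi> GDERIV_radial[OF _ k]]) (use that a in \<open>auto simp: E_def\<close>)
    show "continuous_on E Df"
      unfolding Df_def
      by (intro continuous_intros continuous_on_compose2[OF k1c ncE nE] continuous_on_compose2[OF kc ncE nE]
          continuous_on_subset[OF Dc] continuous_on_subset[OF \<psi>c]) (use a in \<open>auto simp: E_def\<close>)
    show "f x = 0" if "x \<in> E - K" for x using off[of x] that by (simp add: f_def)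
    show "Df x = 0" if "x \<in> E - K" for x using off[of x] that by (simp add: Df_def)
  qed
  have offF: "F x = 0" "DF x = 0" if "x \<notin> K" for x
    using off[OF that] by (auto simp: F_def DF_def f_def Df_def)
  have offR: "b \<le> norm (x - y) \<Longrightarrow> x \<notin> K" for x using K by (auto simp: E_def)
  have "(\<integral>x. (x - y) \<bullet> DF x \<partial>lebesgue) = - real DIM('a) * (\<integral>x. F x \<partial>lebesgue)"
  proof (rule integral_dilation_derivative[where R=b])
    show "GDERIV F x :> DF x" for x using tF by (simp add: C01_test_def)
    show "continuous_on UNIV DF" using tF by (simp add: C01_test_def)
  qed (use offF offR in auto)
  then have A: "(\<integral>x. (x - y) \<bullet> DF x \<partial>lebesgue_on K) = - real DIM('a) * (\<integral>x. F x \<partial>lebesgue_on K)"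
    using integral_lebesgue_restrict[OF meas(1), of "\<lambda>x. (x - y) \<bullet> DF x"] integral_lebesgue_restrict[OF meas(1), of F] offF
    by simp
  have nKc: "continuous_on K (\<lambda>x. norm (x - y))" by (intro continuous_intros)
  have nK: "(\<lambda>x. norm (x - y)) ` K \<subseteq> {a<..<b}" using K nE by blast
  have pos: "norm (x - y) \<noteq> 0" if "x \<in> K" for x using nK that a by auto
  have mc: "continuous_on K (\<lambda>x. m (norm (x - y)))" "continuous_on K (\<lambda>x. m1 (norm (x - y)))"
    unfolding m_def m1_def
    by (intro continuous_intros continuous_on_compose2[OF gc nKc nK] continuous_on_compose2[OF g1 nKc nK];
        use g0 nK in \<open>fastforce\<close>)+
  let ?s = "\<lambda>x. norm (x - y)"
  have i1: "integrable (lebesgue_on K) (\<lambda>x. (m (?s x) / ?s x) * ((x - y) \<bullet> D x))"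
    by (intro integrable_lebesgue_on_compact_continuous K continuous_intros mc continuous_on_subset[OF Dc]) (use pos in auto)
  have i2: "integrable (lebesgue_on K) (\<lambda>x. \<psi> x * (m1 (?s x) - m (?s x) / ?s x))"
    by (intro integrable_lebesgue_on_compact_continuous K continuous_intros mc continuous_on_subset[OF \<psi>c]) (use pos in auto)
  have i3: "integrable (lebesgue_on K) (\<lambda>x. \<psi> x * (m (?s x) / ?s x))"
    by (intro integrable_lebesgue_on_compact_continuous K continuous_intros mc continuous_on_subset[OF \<psi>c]) (use pos in auto)
  have "(\<integral>x. (x - y) \<bullet> DF x \<partial>lebesgue_on K)
      = (\<integral>x. \<psi> x * (m1 (?s x) - m (?s x) / ?s x) + (m (?s x) / ?s x) * ((x - y) \<bullet> D x) \<partial>lebesgue_on K)"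
  proof (rule Bochner_Integration.integral_cong[OF refl])
    fix x assume "x \<in> space (lebesgue_on K)"
    then have x: "x \<in> K" by simp
    have "(x - y) \<bullet> (x - y) = (?s x)\<^sup>2" by (simp add: power2_norm_eq_inner)
    then have "(x - y) \<bullet> Df x = \<psi> x * (k1 (?s x) / ?s x) * (?s x)\<^sup>2 + k (?s x) * ((x - y) \<bullet> D x)"
      by (simp add: Df_def inner_add_right)
    also have "\<psi> x * (k1 (?s x) / ?s x) * (?s x)\<^sup>2 = \<psi> x * (m1 (?s x) - m (?s x) / ?s x)"
      using pos[OF x] by (simp add: k1_def field_simps power2_eq_square)
    finally show "(x - y) \<bullet> DF x = \<psi> x * (m1 (?s x) - m (?s x) / ?s x) + (m (?s x) / ?s x) * ((x - y) \<bullet> D x)"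
      using x K(2) by (auto simp: DF_def k_def)
  qed
  also have "\<dots> = (\<integral>x. \<psi> x * (m1 (?s x) - m (?s x) / ?s x) \<partial>lebesgue_on K) + (\<integral>x. (m (?s x) / ?s x) * ((x - y) \<bullet> D x) \<partial>lebesgue_on K)"
    by (rule Bochner_Integration.integral_add[OF i2 i1])
  finally have B: "(\<integral>x. (m (?s x) / ?s x) * ((x - y) \<bullet> D x) \<partial>lebesgue_on K)
     = - real DIM('a) * (\<integral>x. F x \<partial>lebesgue_on K) - (\<integral>x. \<psi> x * (m1 (?s x) - m (?s x) / ?s x) \<partial>lebesgue_on K)"
    using A by simp
  have C: "(\<integral>x. F x \<partial>lebesgue_on K) = (\<integral>x. \<psi> x * (m (?s x) / ?s x) \<partial>lebesgue_on K)"
    by (rule Bochner_Integration.integral_cong[OF refl]) (use K(2) in \<open>auto simp: F_def f_def k_def\<close>)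
  let ?L = "\<lambda>x. p_flux p ((- g (?s x) / ?s x) *\<^sub>R (x - y)) \<bullet> D x"
  let ?R = "\<lambda>x. (- ((p - 1) * g (?s x) powr (p - 2) * g1 (?s x)
              + (real DIM('a) - 1) / ?s x * g (?s x) powr (p - 1))) * \<psi> x"
  have "(\<integral>x. ?L x \<partial>lebesgue_on E) = (\<integral>x. ?L x \<partial>lebesgue_on K)"
    by (rule integral_lebesgue_on_extend[OF meas K(2)]) (use off in auto)
  also have "\<dots> = (\<integral>x. - ((m (?s x) / ?s x) * ((x - y) \<bullet> D x)) \<partial>lebesgue_on K)"
  proof (rule Bochner_Integration.integral_cong[OF refl])
    fix x assume "x \<in> space (lebesgue_on K)"
    then have x: "x \<in> K" by simp
    then have s: "a < ?s x" "?s x < b" using nK by auto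
    then have "norm ((- g (?s x) / ?s x) *\<^sub>R (x - y)) = g (?s x)"
      using g0[OF s] a s by (simp add: abs_of_pos) auto
    moreover have "g (?s x) powr (p - 2) * g (?s x) = m (?s x)"
      using powr_mult_base[of "g (?s x)" "p - 2"] g0[OF s] by (simp add: m_def mult.commute)
    ultimately show "?L x = - ((m (?s x) / ?s x) * ((x - y) \<bullet> D x))"
      by (simp add: p_flux_def flip: mult.assoc)
  qed
  also have "\<dots> = real DIM('a) * (\<integral>x. \<psi> x * (m (?s x) / ?s x) \<partial>lebesgue_on K) + (\<integral>x. \<psi> x * (m1 (?s x) - m (?s x) / ?s x) \<partial>lebesgue_on K)"
    using B C by simp
  also have "\<dots> = (\<integral>x. real DIM('a) * (\<psi> x * (m (?s x) / ?s x)) + \<psi> x * (m1 (?s x) - m (?s x) / ?s x) \<partial>lebesgue_on K)"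
    by (subst Bochner_Integration.integral_add[OF integrable_mult_right[OF i3] i2]) (simp only: integral_mult_right_zero)
  also have "\<dots> = (\<integral>x. - ?R x \<partial>lebesgue_on K)"
    by (rule Bochner_Integration.integral_cong[OF refl]) (simp add: m_def m1_def algebra_simps diff_divide_distrib)
  also have "\<dots> = - (\<integral>x. ?R x \<partial>lebesgue_on K)"
    by (rule Bochner_Integration.integral_minus)
  also have "(\<integral>x. ?R x \<partial>lebesgue_on K) = (\<integral>x. ?R x \<partial>lebesgue_on E)"
    by (rule integral_lebesgue_on_extend[OF meas K(2), symmetric]) (use off in auto)
  finally show ?thesis unfolding E_def .
qed

text \<open>A radial decreasing strict subsolution on an annulus stays below the solution if it does so near both
  bounding spheres. With this, the partial differential equation is reduced to the ordinary differential
  inequality \<open>ode\<close>.\<close>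

lemma annulus_comparison:
  fixes y :: "'a::euclidean_space" and \<phi> g g1 :: "real \<Rightarrow> real"
  assumes \<Omega>: "open \<Omega>" "cball y b \<subseteq> \<Omega>" and lam0m: "lam0 \<in> borel_measurable (lebesgue_on \<Omega>)"
    and lam0: "\<And>x. x \<in> \<Omega> \<Longrightarrow> 0 \<le> lam0 x" "\<And>x. x \<in> \<Omega> \<Longrightarrow> lam0 x \<le> \<Lambda>"
    and pq: "2 \<le> p" "0 \<le> q" and sol: "weak_solution p q lam0 \<Omega> g0 u"
    and ab: "0 < a" "a < a'" "b' < b"
    and \<phi>: "\<And>s. a < s \<Longrightarrow> s < b \<Longrightarrow> (\<phi> has_real_derivative - g s) (at s)"
    and g: "\<And>s. a < s \<Longrightarrow> s < b \<Longrightarrow> (g has_real_derivative g1 s) (at s)"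
    and gpos: "\<And>s. a < s \<Longrightarrow> s < b \<Longrightarrow> 0 < g s"
    and g1: "continuous_on {a<..<b} g1"
    and \<theta>: "0 < \<theta>"
    and ode: "\<And>s. a < s \<Longrightarrow> s < b \<Longrightarrow> \<Lambda> * max (\<phi> s) 0 powr q + \<theta>
        \<le> - ((p - 1) * g s powr (p - 2) * g1 s + (real DIM('a) - 1) / s * g s powr (p - 1))"
    and inner: "\<And>x. a < norm (x - y) \<Longrightarrow> norm (x - y) < a' \<Longrightarrow> \<phi> (norm (x - y)) \<le> u x"
    and outer: "\<And>x. b' < norm (x - y) \<Longrightarrow> norm (x - y) < b \<Longrightarrow> \<phi> (norm (x - y)) \<le> u x"
    and z: "a < norm (z - y)" "norm (z - y) < b"
  shows "\<phi> (norm (z - y)) \<le> u z"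
proof -
  define E where "E = {x. a < norm (x - y) \<and> norm (x - y) < b}"
  define K where "K = {x. a' \<le> norm (x - y) \<and> norm (x - y) \<le> b'}"
  have E: "open E" unfolding E_def
    by (intro open_Collect_conj open_Collect_less continuous_intros)
  have "closed K" unfolding K_def
    by (intro closed_Collect_conj closed_Collect_le continuous_intros)
  moreover have "K \<subseteq> cball y b'" by (auto simp: K_def dist_norm norm_minus_commute)
  ultimately have K: "compact K" "K \<subseteq> E"
    using ab bounded_subset[OF bounded_cball] by (auto simp: compact_eq_bounded_closed K_def E_def)
  have clE: "closure E \<subseteq> cball y b"
    by (rule closure_minimal) (auto simp: E_def dist_norm norm_minus_commute)
  have cE: "compact (closure E)" "closure E \<subseteq> \<Omega>"
    using clE \<Omega> bounded_subset[OF bounded_cball clE] by (auto simp: compact_eq_bounded_closed)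
  have gc: "continuous_on {a<..<b} g"
    using g by (meson DERIV_isCont continuous_at_imp_continuous_on greaterThanLessThan_iff)
  have ncE: "continuous_on E (\<lambda>x. norm (x - y))" by (intro continuous_intros)
  have nE: "(\<lambda>x. norm (x - y)) ` E \<subseteq> {a<..<b}" by (auto simp: E_def)
  define h where "h s = - ((p - 1) * g s powr (p - 2) * g1 s + (real DIM('a) - 1) / s * g s powr (p - 1))" for s
  have hc: "continuous_on {a<..<b} h"
    unfolding h_def
    by (intro continuous_intros gc g1) (use gpos ab in \<open>auto simp: less_imp_neq[symmetric]\<close>)
  show ?thesis
  proof (rule weak_comparison_principle[OF \<Omega>(1) lam0m lam0 pq sol E cE K, where \<theta>=\<theta>])
    show "GDERIV (\<lambda>x. \<phi> (norm (x - y))) x :> (- g (norm (x - y)) / norm (x - y)) *\<^sub>R (x - y)" if "x \<in> E" for x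
      by (rule GDERIV_radial[OF _ \<phi>]) (use that ab in \<open>auto simp: E_def\<close>)
    show "continuous_on E (\<lambda>x. (- g (norm (x - y)) / norm (x - y)) *\<^sub>R (x - y))"
      by (intro continuous_intros continuous_on_compose2[OF gc ncE nE]) (use ab in \<open>auto simp: E_def\<close>)
    show "\<phi> (norm (x - y)) \<le> u x" if "x \<in> E - K" for x
      using that inner[of x] outer[of x] by (auto simp: E_def K_def)
    show "continuous_on E (\<lambda>x. h (norm (x - y)))"
      by (rule continuous_on_compose2[OF hc ncE nE])
    show "lam0 x * max (\<phi> (norm (x - y))) 0 powr q + \<theta> \<le> h (norm (x - y))" if x: "x \<in> E" for x
    proof -
      have "x \<in> \<Omega>" using x cE(2) closure_subset[of E] by auto
      then have "lam0 x * max (\<phi> (norm (x - y))) 0 powr q \<le> \<Lambda> * max (\<phi> (norm (x - y))) 0 powr q"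
        using lam0(2) by (intro mult_right_mono) auto
      then show ?thesis using ode[of "norm (x - y)"] x by (simp add: E_def h_def)
    qed
    show "(\<integral>x. p_flux p ((- g (norm (x - y)) / norm (x - y)) *\<^sub>R (x - y)) \<bullet> D x \<partial>lebesgue_on E)
        \<le> - (\<integral>x. h (norm (x - y)) * \<psi> x \<partial>lebesgue_on E)" if "C01_test E \<psi> D" for \<psi> D
      unfolding h_def E_def
      by (rule eq_refl, rule radial_weak_p_Laplacian[OF pq(1) ab(1) g gpos g1 that[unfolded E_def]])
    show "z \<in> E" using z by (simp add: E_def)
  qed (simp_all add: \<theta>)
qed

section \<open>The barrier for large exponents\<close>

text \<open>The absorption exponent \<open>q p\<close> differs from \<open>l * (p - 1)\<close> by
  \<open>o(p)\<close> only, so a slope that beats the critical one by a fixed factor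
  \<open>c > 1\<close> wins exponentially.\<close>

lemma eventually_exponential_dominates:
  fixes q :: "real \<Rightarrow> real"
  assumes q: "((\<lambda>p. q p / p) \<longlongrightarrow> l) at_top" and \<Lambda>: "0 \<le> \<Lambda>" and B: "1 \<le> B" and \<alpha>: "0 \<le> \<alpha>" and c: "1 < c"
  shows "\<forall>\<^sub>F p in at_top. \<Lambda> * B powr (\<alpha> * \<bar>q p - l * (p - 1)\<bar>) + 1 \<le> c powr (p - 1)"
proof -
  (* After taking logarithms and dividing by p, only ln c survives in the limit. *)
  have 1: "((\<lambda>p::real. 1 / p) \<longlongrightarrow> 0) at_top"
    using tendsto_inverse_0_at_top[OF filterlim_ident] by (simp add: inverse_eq_divide)
  have "((\<lambda>p. \<bar>q p / p - l + l * (1 / p)\<bar> * (\<alpha> * ln B) + ln (\<Lambda> + 1) * (1 / p) + ln c * (1 / p)) \<longlongrightarrow>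
      \<bar>l - l + l * 0\<bar> * (\<alpha> * ln B) + ln (\<Lambda> + 1) * 0 + ln c * 0) at_top"
    by (intro tendsto_intros q 1)
  then have "\<forall>\<^sub>F p in at_top. \<bar>q p / p - l + l * (1 / p)\<bar> * (\<alpha> * ln B) + ln (\<Lambda> + 1) * (1 / p) + ln c * (1 / p) < ln c"
    using c by (intro order_tendstoD) auto
  then show ?thesis
    using eventually_gt_at_top[of 0]
  proof eventually_elim
    case (elim p)
    let ?e = "\<alpha> * \<bar>q p - l * (p - 1)\<bar>"
    define X where "X = \<bar>q p / p - l + l * (1 / p)\<bar>"
    have "\<bar>q p / p - l + l * (1 / p)\<bar> * p = \<bar>q p - l * (p - 1)\<bar>"
      using elim(2) by (simp add: abs_mult_pos field_simps)
    then have X: "X * p = \<bar>q p - l * (p - 1)\<bar>" by (simp add: X_def)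
    have "(X * (\<alpha> * ln B) + ln (\<Lambda> + 1) * (1 / p) + ln c * (1 / p)) * p \<le> ln c * p"
      using elim by (intro mult_right_mono) (auto simp: X_def)
    moreover have "(X * (\<alpha> * ln B) + ln (\<Lambda> + 1) * (1 / p) + ln c * (1 / p)) * p
        = (X * p) * (\<alpha> * ln B) + ln (\<Lambda> + 1) + ln c"
      using elim(2) by (simp add: field_simps)
    ultimately have le: "ln (\<Lambda> + 1) + ?e * ln B \<le> (p - 1) * ln c"
      unfolding X by (simp add: algebra_simps)
    have B1: "1 \<le> B powr ?e" using B \<alpha> by (intro ge_one_powr_ge_zero) auto
    have "\<Lambda> * B powr ?e + 1 \<le> (\<Lambda> + 1) * B powr ?e" using B1 by (simp add: algebra_simps)
    also have "\<dots> = exp (ln (\<Lambda> + 1) + ?e * ln B)"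
      using \<Lambda> B by (simp add: exp_add powr_def)
    also have "\<dots> \<le> exp ((p - 1) * ln c)" using le by simp
    also have "\<dots> = c powr (p - 1)" using c by (simp add: powr_def)
    finally show ?case .
  qed
qed

text \<open>The barrier is \<open>barrier_base l r s powr (1 / (1 - l))\<close>, where \<open>s\<close> is the
  distance from the centre. With the linear profile \<open>(1 - l) * (r - s)\<close> its slope would be
  exactly the critical one, namely its \<open>l\<close>-th power. The factor \<open>3 / 2\<close> makes
  the slope supercritical, and the quadratic term makes the profile strictly convex, which is
  indispensable for \<open>l = 0\<close>. The coefficients are chosen such that the value at
  \<open>s = 0\<close> is \<open>(1 - l) * (2 * r)\<close>.\<close>

definition barrier_base :: "real \<Rightarrow> real \<Rightarrow> real \<Rightarrow> real" where
  "barrier_base l r s = (1 - l) * (3 / 2 * (r - s) + (r - s)\<^sup>2 / (2 * r))"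

lemma barrier_base_strict_antimono:
  assumes "l < 1" "0 < r" "s < t" "t \<le> r"
  shows "barrier_base l r t < barrier_base l r s"
proof -
  have "(r - t)\<^sup>2 \<le> (r - s)\<^sup>2" using assms by (intro power_mono) auto
  then have "(r - t)\<^sup>2 / (2 * r) \<le> (r - s)\<^sup>2 / (2 * r)" using assms by (intro divide_right_mono) auto
  then have "3 / 2 * (r - t) + (r - t)\<^sup>2 / (2 * r) < 3 / 2 * (r - s) + (r - s)\<^sup>2 / (2 * r)"
    using assms by (intro add_less_le_mono) auto
  then show ?thesis unfolding barrier_base_def using assms by (intro mult_strict_left_mono) auto
qed

lemma barrier_base_pos:
  assumes "l < 1" "0 < r" "s < r"
  shows "0 < barrier_base l r s"
  using barrier_base_strict_antimono[OF assms order_refl] by (simp add: barrier_base_def)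

lemma barrier_base_0: "0 < r \<Longrightarrow> barrier_base l r 0 = (1 - l) * (2 * r)"
  by (simp add: barrier_base_def power2_eq_square)

lemma DERIV_barrier_base:
  "0 < r \<Longrightarrow> (barrier_base l r has_real_derivative - ((1 - l) * (5 / 2 - s / r))) (at s)"
  unfolding barrier_base_def[abs_def]
  by (auto intro!: derivative_eq_intros simp: field_simps power2_eq_square)

lemma DERIV_barrier:
  assumes l: "l < 1" and r: "0 < r" and s: "s < r"
  shows "((\<lambda>s. barrier_base l r s powr (1 / (1 - l))) has_real_derivative
      - ((5 / 2 - s / r) * barrier_base l r s powr (l / (1 - l)))) (at s)"
proof -
  have e: "1 / (1 - l) - 1 = l / (1 - l)" using l by (simp add: field_simps)
  show ?thesis
    using DERIV_fun_powr[OF DERIV_barrier_base[OF r, of l s] barrier_base_pos[OF l r s], of "1 / (1 - l)"] l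
    by (simp add: e mult_ac)
qed

lemma DERIV_barrier_slope:
  assumes l: "l < 1" and r: "0 < r" and s: "s < r"
  shows "((\<lambda>s. (5 / 2 - s / r) * barrier_base l r s powr (l / (1 - l))) has_real_derivative
      - (barrier_base l r s powr (l / (1 - l)) / r
         + l * (5 / 2 - s / r)\<^sup>2 * barrier_base l r s powr (l / (1 - l) - 1))) (at s)"
proof -
  let ?W = "barrier_base l r s powr (l / (1 - l) - 1)" and ?T = "5 / 2 - s / r"
  have 1: "((\<lambda>s. barrier_base l r s powr (l / (1 - l))) has_real_derivative
      l / (1 - l) * ?W * - ((1 - l) * ?T)) (at s)"
    using DERIV_fun_powr[OF DERIV_barrier_base[OF r, of l s] barrier_base_pos[OF l r s], of "l / (1 - l)"] by simp
  have 2: "((\<lambda>s. 5 / 2 - s / r) has_real_derivative - 1 / r) (at s)"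
    using r by (auto intro!: derivative_eq_intros simp: field_simps)
  have 3: "l / (1 - l) * ?W * - ((1 - l) * ?T) = - (l * ?T * ?W)"
    using l by simp
  have "- 1 / r * V + - (l * T * W) * T = - (V / r + l * T\<^sup>2 * W)" for V T W :: real
    by (simp add: power2_eq_square)
  then show ?thesis
    using DERIV_cong[OF DERIV_mult[OF 2 1[unfolded 3]]] by blast
qed

text \<open>The slope \<open>g\<close> of the barrier \<open>\<phi>\<close> satisfies
  \<open>g \<ge> 3 / 2 * \<phi> powr l\<close> and \<open>- g1 \<ge> 2 / (5 * r) * g\<close>, the latter
  from the convexity of the profile. By the second bound the radial second derivative, which carries the
  factor \<open>p - 1\<close>, dominates the term \<open>(n - 1) / s\<close> for large \<open>p\<close>
  and leaves at least \<open>g powr (p - 1)\<close>. By the first bound this is at least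
  \<open>(3 / 2) powr (p - 1) * \<phi> powr (l * (p - 1))\<close>, which exceeds the absorption
  \<open>\<Lambda> * \<phi> powr q p\<close> exponentially.\<close>

lemma barrier_strict_subsolution:
  fixes l r a b n :: real and q :: "real \<Rightarrow> real"
  assumes l: "0 \<le> l" "l < 1" and r: "0 < r" and ab: "0 < a" "b < r" and c: "0 \<le> c"
    and q: "((\<lambda>p. q p / p) \<longlongrightarrow> l) at_top" and q0: "\<And>p. 2 \<le> p \<Longrightarrow> 0 \<le> q p" and \<Lambda>: "0 \<le> \<Lambda>" and n: "1 \<le> n"
  defines "g \<equiv> \<lambda>s. (5 / 2 - s / r) * barrier_base l r s powr (l / (1 - l))"
  defines "g1 \<equiv> \<lambda>s. - (barrier_base l r s powr (l / (1 - l)) / r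
         + l * (5 / 2 - s / r)\<^sup>2 * barrier_base l r s powr (l / (1 - l) - 1))"
  shows "\<forall>\<^sub>F p in at_top. \<exists>\<theta>>0. \<forall>s. a < s \<and> s < b \<longrightarrow>
      \<Lambda> * max (barrier_base l r s powr (1 / (1 - l)) - c) 0 powr q p + \<theta>
      \<le> - ((p - 1) * g s powr (p - 2) * g1 s + (n - 1) / s * g s powr (p - 1))"
proof -
  define \<alpha> where "\<alpha> = 1 / (1 - l)"
  define \<beta> where "\<beta> = l / (1 - l)"
  have \<alpha>\<beta>: "0 \<le> \<alpha>" "0 \<le> \<beta>" "\<beta> = \<alpha> * l" using l by (auto simp: \<alpha>_def \<beta>_def)
  (* On the annulus the base of the barrier lies between 1 / B and B, so powers of it with exponents
     of size o(p) are subexponential in p. *)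
  define B where "B = max 1 (max (barrier_base l r 0) (inverse (barrier_base l r b)))"
  have w: "0 < barrier_base l r s" "barrier_base l r s \<le> B" "inverse B \<le> barrier_base l r s" if "a < s" "s < b" for s
  proof -
    show pos: "0 < barrier_base l r s" using that ab by (intro barrier_base_pos[OF l(2) r]) auto
    show "barrier_base l r s \<le> B"
      using barrier_base_strict_antimono[OF l(2) r, of 0 s] that ab by (simp add: B_def)
    have bpos: "0 < barrier_base l r b" using ab by (intro barrier_base_pos[OF l(2) r]) auto
    have "barrier_base l r b < barrier_base l r s"
      using barrier_base_strict_antimono[OF l(2) r, of s b] that ab by simp
    moreover have "inverse B \<le> inverse (inverse (barrier_base l r b))"
      using bpos by (intro le_imp_inverse_le) (auto simp: B_def)
    ultimately show "inverse B \<le> barrier_base l r s" by simp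
  qed
  have B: "1 \<le> B" by (simp add: B_def)
  have ev1: "\<forall>\<^sub>F p in at_top. \<Lambda> * B powr (\<alpha> * \<bar>q p - l * (p - 1)\<bar>) + 1 \<le> (3 / 2) powr (p - 1)"
    by (rule eventually_exponential_dominates[OF q \<Lambda> B \<alpha>\<beta>(1)]) simp
  show ?thesis
    using ev1 eventually_ge_at_top[of 2] eventually_ge_at_top[of "1 + (1 + (n - 1) / a) * (5 * r / 2)"]
  proof eventually_elim
    case (elim p)
    have curv: "1 + (n - 1) / a \<le> (p - 1) * (2 / (5 * r))"
      using elim(3) r by (simp add: field_simps)
    show ?case
    (* The margin may shrink with p; this one lies below the power of the base that both sides share. *)
    proof (intro exI[of _ "B powr (- (\<beta> * (p - 1)))"] conjI allI impI)
      show "0 < B powr (- (\<beta> * (p - 1)))" using B by simp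
      fix s assume s: "a < s \<and> s < b"
      let ?w = "barrier_base l r s" and ?T = "5 / 2 - s / r"
      note w = w[of s, OF conjunct1[OF s] conjunct2[OF s]]
      have sr: "0 < s / r" "s / r < 1" using s ab r by auto
      have T: "3 / 2 \<le> ?T" "?T \<le> 5 / 2" using sr by linarith+
      have g: "3 / 2 * ?w powr \<beta> \<le> g s" "0 < g s" "g s \<le> 5 / 2 * ?w powr \<beta>"
        using mult_right_mono[OF T(1), of "?w powr \<beta>"] mult_right_mono[OF T(2), of "?w powr \<beta>"] T(1) w(1)
        by (simp_all add: g_def \<beta>_def)
      have "2 / (5 * r) * g s \<le> ?w powr \<beta> / r"
        using g(3) r by (simp add: field_simps)
      also have "\<dots> \<le> - g1 s" using l w(1) by (simp add: g1_def \<beta>_def)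
      finally have slope: "(p - 1) * g s powr (p - 2) * (2 / (5 * r) * g s) \<le> (p - 1) * g s powr (p - 2) * - g1 s"
        using elim(2) by (intro mult_left_mono) auto
      have gp: "g s powr (p - 2) * g s = g s powr (p - 1)"
        using powr_mult_base[of "g s" "p - 2"] g by (simp add: mult.commute)
      have 1: "(p - 1) * (2 / (5 * r)) * g s powr (p - 1) \<le> - ((p - 1) * g s powr (p - 2) * g1 s)"
      proof -
        have "(p - 1) * (2 / (5 * r)) * g s powr (p - 1) = (p - 1) * g s powr (p - 2) * (2 / (5 * r) * g s)"
          unfolding gp[symmetric] by (simp only: mult_ac)
        also note slope
        also have "(p - 1) * g s powr (p - 2) * - g1 s = - ((p - 1) * g s powr (p - 2) * g1 s)"
          by (rule mult_minus_right)
        finally show ?thesis .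
      qed
      have "(n - 1) / s \<le> (n - 1) / a" using s ab n by (intro divide_left_mono) auto
      then have "(1 + (n - 1) / s) * g s powr (p - 1) \<le> (p - 1) * (2 / (5 * r)) * g s powr (p - 1)"
        using curv by (intro mult_right_mono) auto
      then have "g s powr (p - 1) \<le> - ((p - 1) * g s powr (p - 2) * g1 s + (n - 1) / s * g s powr (p - 1))"
        using 1 by (simp add: algebra_simps)
      moreover have "(3 / 2) powr (p - 1) * ?w powr (\<beta> * (p - 1)) \<le> g s powr (p - 1)"
      proof -
        have "(3 / 2 * ?w powr \<beta>) powr (p - 1) \<le> g s powr (p - 1)"
          using g elim(2) by (intro powr_mono2) auto
        then show ?thesis by (simp only: powr_mult powr_powr)
      qed
      moreover have "\<Lambda> * max (?w powr (1 / (1 - l)) - c) 0 powr q p + B powr (- (\<beta> * (p - 1)))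
          \<le> (3 / 2) powr (p - 1) * ?w powr (\<beta> * (p - 1))"
      proof -
        define \<delta> where "\<delta> = \<alpha> * (q p - l * (p - 1))"
        have "max (?w powr (1 / (1 - l)) - c) 0 powr q p \<le> (?w powr \<alpha>) powr q p"
          using c q0[OF elim(2)] by (intro powr_mono2) (auto simp: \<alpha>_def)
        also have "\<dots> = ?w powr (\<beta> * (p - 1)) * ?w powr \<delta>"
          by (simp add: powr_powr \<delta>_def \<alpha>\<beta>(3) algebra_simps flip: powr_add)
        also have "\<dots> \<le> ?w powr (\<beta> * (p - 1)) * B powr \<bar>\<delta>\<bar>"
        proof (rule mult_left_mono)
          show "?w powr \<delta> \<le> B powr \<bar>\<delta>\<bar>"
          proof (cases "0 \<le> \<delta>")
            case True then show ?thesis using w by (simp add: powr_mono2)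
          next
            case False
            then have "?w powr \<delta> \<le> inverse B powr \<delta>"
              using w B by (intro powr_mono2') auto
            also have "\<dots> = B powr \<bar>\<delta>\<bar>" using False B by (simp add: powr_minus inverse_powr)
            finally show ?thesis .
          qed
        qed simp
        finally have "\<Lambda> * max (?w powr (1 / (1 - l)) - c) 0 powr q p \<le> \<Lambda> * (?w powr (\<beta> * (p - 1)) * B powr \<bar>\<delta>\<bar>)"
          using \<Lambda> by (rule mult_left_mono)
        moreover have "B powr (- (\<beta> * (p - 1))) \<le> ?w powr (\<beta> * (p - 1))"
        proof -
          have "inverse B powr (\<beta> * (p - 1)) \<le> ?w powr (\<beta> * (p - 1))"
            using w B \<alpha>\<beta> elim(2) by (intro powr_mono2) auto
          then show ?thesis using B by (simp add: powr_minus inverse_powr)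
        qed
        moreover have "(\<Lambda> * B powr \<bar>\<delta>\<bar> + 1) * ?w powr (\<beta> * (p - 1)) \<le> (3 / 2) powr (p - 1) * ?w powr (\<beta> * (p - 1))"
          using elim(1) \<alpha>\<beta>(1) by (intro mult_right_mono) (auto simp: \<delta>_def abs_mult)
        ultimately show ?thesis by (simp add: algebra_simps)
      qed
      ultimately show "\<Lambda> * max (?w powr (1 / (1 - l)) - c) 0 powr q p + B powr (- (\<beta> * (p - 1)))
          \<le> - ((p - 1) * g s powr (p - 2) * g1 s + (n - 1) / s * g s powr (p - 1))"
        by linarith
    qed
  qed
qed

section \<open>Growth at the free boundary\<close>

text \<open>Growth away from a zero \<open>x0\<close> of the limit. If \<open>v y\<close> exceeded the top of the
  barrier centred at \<open>y\<close>, comparison would keep \<open>u p x0\<close>, for large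
  \<open>p\<close>, above a positive number independent of \<open>p\<close>: the drop of the barrier
  from distance \<open>norm (x0 - y) < r\<close> to a slightly larger one. This contradicts
  \<open>v x0 = 0\<close>.\<close>

lemma uniform_limit_of_family_zero_growth:
  fixes \<Omega> :: "'a::euclidean_space set"
  assumes \<Omega>: "open \<Omega>" and lam0m: "lam0 \<in> borel_measurable (lebesgue_on \<Omega>)"
    and lam0: "\<And>x. x \<in> \<Omega> \<Longrightarrow> 0 \<le> lam0 x" "\<And>x. x \<in> \<Omega> \<Longrightarrow> lam0 x \<le> \<Lambda>"
    and q0: "\<And>p. 2 \<le> p \<Longrightarrow> 0 \<le> q p" and ql: "((\<lambda>p. q p / p) \<longlongrightarrow> l) at_top" and l: "0 \<le> l" "l < 1"
    and sol: "\<And>p. 2 \<le> p \<Longrightarrow> weak_solution p (q p) lam0 \<Omega> g0 (u p)"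
    and u0: "\<And>p x. 2 \<le> p \<Longrightarrow> x \<in> closure \<Omega> \<Longrightarrow> 0 \<le> u p x"
    and P: "filterlim P at_top sequentially" and lim: "uniform_limit (closure \<Omega>) (\<lambda>j. u (P j)) v sequentially"
    and vc: "continuous_on \<Omega> v" and v0: "v x0 = 0"
    and r: "0 < r" "ball x0 (2 * r) \<subseteq> \<Omega>" and y: "y \<in> ball x0 r"
  shows "v y \<le> ((1 - l) * (2 * r)) powr (1 / (1 - l))"
proof (rule ccontr)
  define \<phi>0 where "\<phi>0 s = barrier_base l r s powr (1 / (1 - l))" for s
  have \<phi>00: "\<phi>0 0 = ((1 - l) * (2 * r)) powr (1 / (1 - l))"
    using r by (simp add: \<phi>0_def barrier_base_0)
  assume "\<not> v y \<le> ((1 - l) * (2 * r)) powr (1 / (1 - l))"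
  then have vy: "\<phi>0 0 < v y" by (simp add: \<phi>00)
  have decr: "\<phi>0 t < \<phi>0 s" if "s < t" "t < r" for s t
    unfolding \<phi>0_def using that l barrier_base_strict_antimono[OF l(2) r(1), of s t] barrier_base_pos[OF l(2) r(1), of t]
    by (intro powr_less_mono2) auto
  define d where "d = norm (x0 - y)"
  have "x0 \<noteq> y" using vy v0 \<phi>00 powr_ge_zero[of "(1 - l) * (2 * r)" "1 / (1 - l)"] by auto
  then have d: "0 < d" "d < r" using y by (auto simp: d_def dist_norm)
  (* d < b' < b < r. Subtracting the value at b' makes the barrier negative near the outer sphere of
     radius b, where only u >= 0 is known, and keeps it positive at distance d. *)
  define b where "b = (d + 2 * r) / 3"
  define b' where "b' = (2 * d + r) / 3"
  have b: "d < b'" "b' < b" "b < r" using d by (auto simp: b_def b'_def)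
  have cb: "cball y b \<subseteq> \<Omega>"
  proof -
    have "cball y b \<subseteq> ball x0 (2 * r)"
      using y b by (simp add: cball_subset_ball_iff dist_commute)
    then show ?thesis using r by blast
  qed
  have x\<Omega>: "y \<in> \<Omega>" "x0 \<in> \<Omega>" using r y by auto
  (* For large p the solutions stay above the top of the barrier on one fixed ball around y; the
     vertex of the barrier, where the p-Laplacian is singular, lies in that ball. *)
  define e where "e = (v y - \<phi>0 0) / 2"
  have e: "0 < e" using vy by (simp add: e_def)
  obtain a' where a': "0 < a'" "\<And>x. x \<in> \<Omega> \<Longrightarrow> dist x y < a' \<Longrightarrow> dist (v x) (v y) < e"
    using vc x\<Omega>(1) e unfolding continuous_on_iff by blast
  define A where "A = min a' d"
  have A: "0 < A" "A \<le> d" "A \<le> a'" using a' d by (auto simp: A_def)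
  define a where "a = A / 2"
  have a: "0 < a" "a < A" using A by (auto simp: a_def)
  define \<phi> where "\<phi> s = \<phi>0 s - \<phi>0 b'" for s
  have \<phi>b': "0 \<le> \<phi>0 b'" by (simp add: \<phi>0_def)
  have n1: "1 \<le> real DIM('a)" using DIM_positive[where 'a='a] by linarith
  have \<Lambda>: "0 \<le> \<Lambda>" using lam0[OF x\<Omega>(1)] by linarith
  define g where "g s = (5 / 2 - s / r) * barrier_base l r s powr (l / (1 - l))" for s
  define g1 where "g1 s = - (barrier_base l r s powr (l / (1 - l)) / r
         + l * (5 / 2 - s / r)\<^sup>2 * barrier_base l r s powr (l / (1 - l) - 1))" for s
  have ode: "\<forall>\<^sub>F p in at_top. \<exists>\<theta>>0. \<forall>s. a < s \<and> s < b \<longrightarrow>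
      \<Lambda> * max (\<phi> s) 0 powr q p + \<theta>
      \<le> - ((p - 1) * g s powr (p - 2) * g1 s + (real DIM('a) - 1) / s * g s powr (p - 1))"
    unfolding \<phi>_def \<phi>0_def[of "_::real"] g_def g1_def
    using barrier_strict_subsolution[OF l r(1) a(1) b(3) \<phi>b' ql q0 \<Lambda> n1] unfolding \<phi>0_def by simp
  have ev: "\<forall>\<^sub>F j in sequentially. \<forall>x\<in>closure \<Omega>. dist (u (P j) x) (v x) < e"
    using lim e by (rule uniform_limitD)
  have key: "\<forall>\<^sub>F j in sequentially. \<phi> d \<le> u (P j) x0"
    using ev eventually_compose_filterlim[OF ode P] eventually_compose_filterlim[OF eventually_ge_at_top[of 2] P]
  proof eventually_elim
    case (elim j)
    obtain \<theta> where \<theta>: "0 < \<theta>" and od: "\<And>s. a < s \<Longrightarrow> s < b \<Longrightarrow>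
      \<Lambda> * max (\<phi> s) 0 powr q (P j) + \<theta>
      \<le> - ((P j - 1) * g s powr (P j - 2) * g1 s + (real DIM('a) - 1) / s * g s powr (P j - 1))"
      using elim(2) by blast
    have w: "0 < barrier_base l r s" if "s < b" for s
      using barrier_base_pos[OF l(2) r(1)] that b by simp
    have "\<phi> (norm (x0 - y)) \<le> u (P j) x0"
    proof (rule annulus_comparison[OF \<Omega> cb lam0m lam0 elim(3) q0[OF elim(3)] sol[OF elim(3)] a b(2), where \<theta>=\<theta> and ?g1.0=g1])
      show "(\<phi> has_real_derivative - g s) (at s)" if "a < s" "s < b" for s
        unfolding \<phi>_def[abs_def] \<phi>0_def[abs_def] g_def
        using DERIV_diff[OF DERIV_barrier[OF l(2) r(1), of s] DERIV_const] that b by simp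
      show "(g has_real_derivative g1 s) (at s)" if "a < s" "s < b" for s
        unfolding g_def[abs_def] g1_def
        by (rule DERIV_barrier_slope[OF l(2) r(1)]) (use that b in auto)
      show "0 < g s" if "a < s" "s < b" for s
      proof -
        have "s / r < 1" using that b r by simp
        then have "0 < 5 / 2 - s / r" by linarith
        then show ?thesis unfolding g_def using w[OF that(2)] by simp
      qed
      show "continuous_on {a<..<b} g1"
      proof -
        have c: "continuous_on {a<..<b} (barrier_base l r)"
          unfolding barrier_base_def[abs_def] by (intro continuous_intros) (use r in auto)
        show ?thesis
          unfolding g1_def by (intro continuous_intros c) (use w r in \<open>auto simp: less_imp_neq[symmetric]\<close>)
      qed
      show "\<phi> (norm (x - y)) \<le> u (P j) x" if x: "a < norm (x - y)" "norm (x - y) < A" for x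
      proof -
        have "x \<in> cball y b" using x A b by (simp add: dist_norm norm_minus_commute)
        then have x\<Omega>: "x \<in> \<Omega>" using cb by auto
        have "dist (v x) (v y) < e" using a'(2)[OF x\<Omega>] x A by (simp add: dist_norm)
        moreover have "dist (u (P j) x) (v x) < e" using elim(1) x\<Omega> closure_subset by blast
        ultimately have "\<phi>0 0 \<le> u (P j) x" unfolding dist_real_def abs_less_iff e_def by argo
        moreover have "\<phi>0 (norm (x - y)) < \<phi>0 0" by (rule decr) (use x A b a in linarith)+
        ultimately show ?thesis unfolding \<phi>_def using \<phi>b' by linarith
      qed
      show "\<phi> (norm (x - y)) \<le> u (P j) x" if x: "b' < norm (x - y)" "norm (x - y) < b" for x
      proof -
        have "x \<in> cball y b" using x by (simp add: dist_norm norm_minus_commute)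
        then have "x \<in> closure \<Omega>" using cb closure_subset by blast
        then have "0 \<le> u (P j) x" using u0[OF elim(3)] by blast
        moreover have "\<phi>0 (norm (x - y)) < \<phi>0 b'" using decr x b by simp
        ultimately show ?thesis by (simp add: \<phi>_def)
      qed
      show "a < norm (x0 - y)" "norm (x0 - y) < b" using a A b by (auto simp: d_def)
    qed (use \<theta> od in auto)
    then show ?case by (simp add: d_def)
  qed
  have "(\<lambda>j. u (P j) x0) \<longlonglongrightarrow> v x0"
    by (rule tendsto_uniform_limitI[OF lim]) (use x\<Omega>(2) closure_subset in blast)
  then have "\<phi> d \<le> v x0"
    by (rule tendsto_lowerbound[OF _ key]) simp
  moreover have "0 < \<phi> d" using decr[OF b(1)] b by (simp add: \<phi>_def)
  ultimately show False using v0 by simp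
qed

theorem theorem1p4:
  fixes \<Omega> \<Omega>' :: "'a::euclidean_space set"
    and lam0 g u_inf :: "'a \<Rightarrow> real"
    and q :: "real \<Rightarrow> real"
    and u :: "real \<Rightarrow> 'a \<Rightarrow> real"
    and l :: real
  assumes "regular_bounded_domain \<Omega>"
    and "lam0 \<in> borel_measurable (lebesgue_on \<Omega>)"
    and "bounded (lam0 ` \<Omega>)" and "0 < (INF x\<in>\<Omega>. lam0 x)"
    and "\<exists>L. L-lipschitz_on (frontier \<Omega>) g" and "\<forall>x\<in>frontier \<Omega>. 0 \<le> g x"
    and "\<forall>p\<ge>2. 0 \<le> q p \<and> q p < p - 1"
    and "((\<lambda>p. q p / p) \<longlongrightarrow> l) at_top" and "0 \<le> l" and "l < 1"
    and "\<forall>p\<ge>2. weak_solution p (q p) lam0 \<Omega> g (u p) \<and> (\<forall>x\<in>closure \<Omega>. 0 \<le> u p x)"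
    and "uniform_limit_of_family \<Omega> u u_inf"
    and "compactly_contained \<Omega>' \<Omega>"
  shows "\<exists>r0>0. \<forall>x0 \<in> frontier {x\<in>\<Omega>. u_inf x > 0} \<inter> \<Omega>'. \<forall>r. 0 < r \<and> r < r0 \<longrightarrow>
           (SUP x\<in>ball x0 r. u_inf x)
             \<le> 2 * 2 powr (1 / (1 - l)) * (1 - l) powr (1 / (1 - l)) * r powr (1 / (1 - l))"
proof -
  have \<Omega>: "open \<Omega>" using assms(1) by (simp add: regular_bounded_domain_def)
  obtain \<Lambda> where \<Lambda>: "\<And>x. x \<in> \<Omega> \<Longrightarrow> \<bar>lam0 x\<bar> \<le> \<Lambda>"
    using assms(3) by (auto simp: bounded_iff)
  have lam0: "0 \<le> lam0 x" "lam0 x \<le> \<Lambda>" if "x \<in> \<Omega>" for x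
  proof -
    have "(INF x\<in>\<Omega>. lam0 x) \<le> lam0 x"
      by (rule cINF_lower[OF bounded_imp_bdd_below[OF assms(3)] that])
    then show "0 \<le> lam0 x" using assms(4) by linarith
    show "lam0 x \<le> \<Lambda>" using \<Lambda>[OF that] by linarith
  qed
  obtain P where P: "filterlim P at_top sequentially" and lim: "uniform_limit (closure \<Omega>) (\<lambda>j. u (P j)) u_inf sequentially"
    using assms(12) by (auto simp: uniform_limit_of_family_def)
  have ev2: "\<forall>\<^sub>F j in sequentially. 2 \<le> P j"
    using P by (simp add: filterlim_at_top)
  have "continuous_on (closure \<Omega>) u_inf"
  proof (rule uniform_limit_theorem[OF _ lim])
    show "\<forall>\<^sub>F j in sequentially. continuous_on (closure \<Omega>) (u (P j))"
      using ev2 assms(11) by (auto elim!: eventually_mono simp: weak_solution_def)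
  qed simp
  then have vc: "continuous_on \<Omega> u_inf"
    using closure_subset by (rule continuous_on_subset)
  have v0: "0 \<le> u_inf x" if "x \<in> \<Omega>" for x
  proof (rule tendsto_lowerbound)
    show "(\<lambda>j. u (P j) x) \<longlonglongrightarrow> u_inf x"
      by (rule tendsto_uniform_limitI[OF lim]) (use that closure_subset in blast)
    show "\<forall>\<^sub>F j in sequentially. 0 \<le> u (P j) x"
      using ev2 by eventually_elim (use assms(11) that closure_subset in blast)
  qed simp
  have opos: "open {x \<in> \<Omega>. 0 < u_inf x}"
  proof -
    have "open (u_inf -` {0<..} \<inter> \<Omega>)"
      using vc continuous_on_open_vimage[OF \<Omega>, of u_inf] open_greaterThan by blast
    moreover have "u_inf -` {0<..} \<inter> \<Omega> = {x \<in> \<Omega>. 0 < u_inf x}" by auto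
    ultimately show ?thesis by simp
  qed
  obtain e where e: "0 < e" "(\<Union>x\<in>closure \<Omega>'. cball x e) \<subseteq> \<Omega>"
    using assms(13) compact_subset_open_imp_cball_epsilon_subset[OF _ \<Omega>] unfolding compactly_contained_def by blast
  show ?thesis
  proof (intro exI[of _ "e / 2"] conjI ballI allI impI)
    show "0 < e / 2" using e by simp
    fix x0 r assume x0: "x0 \<in> frontier {x\<in>\<Omega>. u_inf x > 0} \<inter> \<Omega>'" and r: "0 < r \<and> r < e / 2"
    have x0': "x0 \<in> closure \<Omega>'" using x0 closure_subset by blast
    have "cball x0 e \<subseteq> \<Omega>" using e(2) x0' by blast
    then have b: "ball x0 (2 * r) \<subseteq> \<Omega>" "x0 \<in> \<Omega>" using r e by auto
    have "x0 \<notin> {x \<in> \<Omega>. 0 < u_inf x}"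
      using x0 opos by (simp add: frontier_def interior_open)
    then have z: "u_inf x0 = 0" using v0[OF b(2)] b(2) by auto
    have "u_inf y \<le> ((1 - l) * (2 * r)) powr (1 / (1 - l))" if "y \<in> ball x0 r" for y
      by (rule uniform_limit_of_family_zero_growth[OF \<Omega> assms(2) lam0 _ assms(8-10) _ _ P lim vc z _ b(1) that])
        (use assms(7,11) r in auto)
    then have "(SUP x\<in>ball x0 r. u_inf x) \<le> ((1 - l) * (2 * r)) powr (1 / (1 - l))"
      using r by (intro cSUP_least) auto
    also have "\<dots> = 2 powr (1 / (1 - l)) * (1 - l) powr (1 / (1 - l)) * r powr (1 / (1 - l))"
      using r assms(10) by (simp add: powr_mult)
    also have "\<dots> \<le> 2 * (2 powr (1 / (1 - l)) * (1 - l) powr (1 / (1 - l)) * r powr (1 / (1 - l)))"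
    proof -
      have "0 \<le> 2 powr (1 / (1 - l)) * (1 - l) powr (1 / (1 - l)) * r powr (1 / (1 - l))" by simp
      then show ?thesis by linarith
    qed
    finally show "(SUP x\<in>ball x0 r. u_inf x)
             \<le> 2 * 2 powr (1 / (1 - l)) * (1 - l) powr (1 / (1 - l)) * r powr (1 / (1 - l))"
      by (simp only: mult.assoc)
  qed
qed

end
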